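(* Let $d \ge 2$ be a fixed integer. For each $n \in \mathbb{N}$ let $\mu_n$ be a probability distribution on the symmetric group $S_d$ whose single ball transition matrix $U_n$ is irreducible, and let $\Phi_*^{(n)}$ and $\gamma_n$ be the Cheeger constant and spectral gap of $U_n$. Let $t^{(n)}_{\mathrm{mix,single}}(1/\sqrt n)$ denote the $(1/\sqrt{n})$-total variation mixing time of the continuous-time rate $1$ single ball chain with transition matrix $U_n$. (i) If $\Phi_*^{(n)} = \Omega(1)$, then $$\frac{\log n}{2\gamma_n} - O(1) \le t^{(n)}_{\mathrm{mix,single}}(1/\sqrt n) \le \frac{\log n}{2\gamma_n} + O(\log\log n).$$ (ii) If $\mu_n$ is symmetric for each $n \in \mathbb{N}$ (with no condition on $\Phi_*^{(n)}$), then $$\frac{\log n}{2\gamma_n} - O\!\left(\frac{1}{\gamma_n}\right) \le t^{(n)}_{\mathrm{mix,single}}(1/\sqrt n) \le \frac{\log n}{2\gamma_n} + O\!\left(\frac{1}{\gamma_n}\right).$$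
   Context: Notation: $[d]=\{1,\dots,d\}$; $\nu_0$ is the uniform distribution on $[d]$. For a distribution $\mu$ on $S_d$, the single ball transition matrix is the $d\times d$ doubly stochastic matrix $U(i,j)=\mathbb{P}_{\sigma\sim\mu}(\sigma(i)=j)$; its stationary distribution is $\nu_0$. $\mu$ is symmetric if $\mu(\sigma)=\mu(\sigma^{-1})$ for all $\sigma\in S_d$. Cheeger constant: $\Phi_*(U)=\min_{A\subseteq[d],\,0<\nu_0(A)\le 1/2}\ \frac{\sum_{x\in A,y\in A^c}\nu_0(x)U(x,y)}{\nu_0(A)}$. Spectral gap: $\gamma(U)=\min\{1-\mathrm{Re}(\lambda): U\mathbf v=\lambda \mathbf v \text{ for some non-constant } \mathbf v\in\mathbb{C}^d\}$. The rate $1$ single ball chain is the continuous-time Markov chain on $[d]$ with transition kernel $e^{t(U_n-I)}$, and $t^{(n)}_{\mathrm{mix,single}}(\varepsilon)=\inf\{t\ge0:\max_{i\in[d]}\|e^{t(U_n-I)}(i,\cdot)-\nu_0\|_{\mathrm{TV}}\le\varepsilon\}$. Asymptotic notation is as $n\to\infty$, for all sufficiently large $n$; $f=O(g)$ means $f\le C_0 g$ for a constant $C_0$ not depending on $n$, and $f=\Omega(g)$ means $g=O(f)$. *)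

theory Defs
  imports
    "Jordan_Normal_Form.Char_Poly"
    "HOL-Probability.Probability_Mass_Function"
    "HOL-Combinatorics.Permutations"
    "HOL-Library.Landau_Symbols"
begin

text \<open>
  The state space \<open>[d]\<close> is \<open>{..<d}\<close>, matching the 0-based index convention of the matrix type.
  An element of \<open>S\<^sub>d\<close> is a function \<open>\<sigma> :: nat \<Rightarrow> nat\<close> with \<open>\<sigma> permutes {..<d}\<close>.
\<close>

definition uniform_dist :: "nat \<Rightarrow> nat pmf" where
  "uniform_dist d = pmf_of_set {..<d}"

definition distribution_on_Sym :: "nat \<Rightarrow> (nat \<Rightarrow> nat) pmf \<Rightarrow> bool" where
  "distribution_on_Sym d \<mu> \<longleftrightarrow> set_pmf \<mu> \<subseteq> {\<sigma>. \<sigma> permutes {..<d}}"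

definition symmetric_dist :: "nat \<Rightarrow> (nat \<Rightarrow> nat) pmf \<Rightarrow> bool" where
  "symmetric_dist d \<mu> \<longleftrightarrow> (\<forall>\<sigma>. \<sigma> permutes {..<d} \<longrightarrow> pmf \<mu> \<sigma> = pmf \<mu> (inv_into UNIV \<sigma>))"

definition single_ball_matrix :: "nat \<Rightarrow> (nat \<Rightarrow> nat) pmf \<Rightarrow> real mat" where
  "single_ball_matrix d \<mu> = Matrix.mat d d (\<lambda>(i, j). measure_pmf.prob \<mu> {\<sigma>. \<sigma> i = j})"

definition irreducible_matrix :: "nat \<Rightarrow> real mat \<Rightarrow> bool" where
  "irreducible_matrix d U \<longleftrightarrow> (\<forall>i<d. \<forall>j<d. \<exists>k. (U ^\<^sub>m k) $$ (i, j) > 0)"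

definition cheeger_constant :: "nat \<Rightarrow> real mat \<Rightarrow> real" where
  "cheeger_constant d U =
     Min ((\<lambda>A. (\<Sum>x\<in>A. \<Sum>y\<in>{..<d} - A. pmf (uniform_dist d) x * U $$ (x, y))
               / measure_pmf.prob (uniform_dist d) A)
          ` {A. A \<subseteq> {..<d} \<and> 0 < measure_pmf.prob (uniform_dist d) A
                \<and> measure_pmf.prob (uniform_dist d) A \<le> 1 / 2})"

definition spectral_gap :: "nat \<Rightarrow> real mat \<Rightarrow> real" where
  "spectral_gap d U =
     Min {1 - Re l | l. \<exists>v. eigenvector (map_mat complex_of_real U) v l
                          \<and> (\<exists>i<d. \<exists>j<d. vec_index v i \<noteq> vec_index v j)}"

text \<open>The exponential power series, summed entry by entry.\<close>

definition mat_exp :: "nat \<Rightarrow> real mat \<Rightarrow> real mat" where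
  "mat_exp d A = Matrix.mat d d (\<lambda>(i, j). \<Sum>k. (A ^\<^sub>m k) $$ (i, j) / fact k)"

definition tv_dist :: "nat \<Rightarrow> (nat \<Rightarrow> real) \<Rightarrow> (nat \<Rightarrow> real) \<Rightarrow> real" where
  "tv_dist d p q = Max ((\<lambda>A. \<bar>(\<Sum>x\<in>A. p x) - (\<Sum>x\<in>A. q x)\<bar>) ` Pow {..<d})"

definition single_ball_kernel :: "nat \<Rightarrow> real mat \<Rightarrow> real \<Rightarrow> real mat" where
  "single_ball_kernel d U t = mat_exp d (t \<cdot>\<^sub>m (U - 1\<^sub>m d))"

definition t_mix_single :: "nat \<Rightarrow> real mat \<Rightarrow> real \<Rightarrow> real" where
  "t_mix_single d U \<epsilon> =
     Inf {t. 0 \<le> t \<and>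
             Max ((\<lambda>i. tv_dist d (\<lambda>j. single_ball_kernel d U t $$ (i, j)) (pmf (uniform_dist d)))
                  ` {..<d}) \<le> \<epsilon>}"

end

theory Submission
  imports Defs "HOL-Real_Asymp.Real_Asymp"
begin

text \<open>
  Let \<open>X t v = exp (t (U - I)) v\<close>. A non-constant eigenvector realising the gap decays exactly like
  \<open>exp (- \<gamma> t)\<close>, which gives the lower bound. Conversely, for \<open>v\<close> of sum zero take a polynomial
  \<open>\<Prod> (x - m\<^sub>i)\<close> of least degree \<open>k \<le> d\<close> with \<open>\<Prod> (U - m\<^sub>i) v = 0\<close>; minimality makes every \<open>m\<^sub>i\<close> an
  eigenvalue with an eigenvector of sum zero, so \<open>Re m\<^sub>i \<le> 1 - \<gamma>\<close>, and solving one scalar linear ODE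
  per factor yields \<open>\<bar>X t v\<bar> \<le> 2 ^ d (1 + t) ^ d exp (- \<gamma> t)\<close> without any diagonalisation. The
  polynomial factor costs \<open>O(ln (ln n))\<close> once \<open>\<gamma>\<close> is bounded below, and
  \<open>\<gamma> \<ge> \<Phi> / d ^ 5\<close> by a Poincare inequality. For symmetric \<open>U\<close> the polynomial factor disappears: the
  squared Euclidean norm \<open>N t\<close> of \<open>X t v\<close> satisfies \<open>(N t)\<^sup>2 \<le> N 0 * N (2 t)\<close>, and iterating this along
  \<open>2 ^ m t\<close> turns a bound with polynomial prefactor into \<open>N t \<le> N 0 * exp (- 2 \<gamma> t)\<close>.
\<close>

text \<open>Row sums make the matrix a contraction in the sup norm, and column sums make it preserve
  the sum of a vector. The analysis is carried out for any such matrix; permutations return only at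
  the end.\<close>

locale doubly_stochastic =
  fixes d :: nat and U :: "real mat"
  assumes carrier [simp, intro]: "U \<in> carrier_mat d d"
    and nonneg: "\<And>i j. i < d \<Longrightarrow> j < d \<Longrightarrow> 0 \<le> U $$ (i, j)"
    and row_sum: "\<And>i. i < d \<Longrightarrow> (\<Sum>j<d. U $$ (i, j)) = 1"
    and col_sum: "\<And>j. j < d \<Longrightarrow> (\<Sum>i<d. U $$ (i, j)) = 1"
begin

subsection \<open>The heat kernel\<close>

text \<open>The generator of the rate 1 chain.\<close>

definition B :: "real mat" where
  "B = U - 1\<^sub>m d"

definition P :: "real \<Rightarrow> nat \<Rightarrow> nat \<Rightarrow> real" where
  "P t i j = single_ball_kernel d U t $$ (i, j)"

lemma B_carrier [simp, intro]: "B \<in> carrier_mat d d"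
  unfolding B_def by (intro minus_carrier_mat one_carrier_mat)

lemma B_dim [simp]: "dim_row B = d" "dim_col B = d"
  using B_carrier by (simp_all only: carrier_matD)

lemma B_index: "i < d \<Longrightarrow> j < d \<Longrightarrow> B $$ (i, j) = U $$ (i, j) - (if i = j then 1 else 0)"
  by (subst B_def, subst index_minus_mat) auto

lemma index_mult_sum:
  fixes A C :: "real mat"
  assumes "A \<in> carrier_mat d d" "C \<in> carrier_mat d d" "i < d" "j < d"
  shows "(A * C) $$ (i, j) = (\<Sum>l<d. A $$ (i, l) * C $$ (l, j))"
  using assms by (auto simp: scalar_prod_def lessThan_atLeast0)

lemma pow_carrier [simp, intro]: "B ^\<^sub>m k \<in> carrier_mat d d"
  by (rule pow_carrier_mat) simp

lemma pow_dim [simp]: "dim_row (B ^\<^sub>m k) = d" "dim_col (B ^\<^sub>m k) = d"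
  using pow_carrier[of k] by (simp_all only: carrier_matD)

text \<open>\<open>pow_mat\<close> multiplies on the right; the left recursion is what turns the
  differentiated series into \<open>B\<close> times \<open>P\<close>.\<close>

lemma pow_Suc_left: "B ^\<^sub>m Suc k = B * B ^\<^sub>m k"
proof (induction k)
  case 0
  show ?case using left_mult_one_mat[OF B_carrier] right_mult_one_mat[OF B_carrier] by simp
next
  case (Suc k)
  have "B ^\<^sub>m Suc (Suc k) = (B * B ^\<^sub>m k) * B" using Suc by simp
  also have "\<dots> = B * (B ^\<^sub>m k * B)" by (rule assoc_mult_mat) auto
  finally show ?case by simp
qed

lemma pow_index_right:
  assumes "i < d" "j < d"
  shows "(B ^\<^sub>m Suc k) $$ (i, j) = (\<Sum>l<d. (B ^\<^sub>m k) $$ (i, l) * B $$ (l, j))"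
  using index_mult_sum[OF pow_carrier B_carrier assms] by simp

lemma pow_index_left:
  assumes "i < d" "j < d"
  shows "(B ^\<^sub>m Suc k) $$ (i, j) = (\<Sum>l<d. B $$ (i, l) * (B ^\<^sub>m k) $$ (l, j))"
  unfolding pow_Suc_left by (rule index_mult_sum[OF B_carrier pow_carrier assms])

lemma B_row_abs: assumes "i < d" shows "(\<Sum>j<d. \<bar>B $$ (i, j)\<bar>) \<le> 2"
proof -
  have "(\<Sum>j<d. \<bar>B $$ (i, j)\<bar>) \<le> (\<Sum>j<d. U $$ (i, j) + (if i = j then 1 else 0))"
  proof (intro sum_mono)
    fix j assume "j \<in> {..<d}"
    then show "\<bar>B $$ (i, j)\<bar> \<le> U $$ (i, j) + (if i = j then 1 else 0)"
      using nonneg[of i j] assms by (cases "i = j") (auto simp: B_index)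
  qed
  also have "\<dots> = 2" using assms by (simp add: sum.distrib row_sum)
  finally show ?thesis .
qed

lemma B_row_sum: "i < d \<Longrightarrow> (\<Sum>j<d. B $$ (i, j)) = 0"
  by (simp add: B_index sum_subtractf row_sum)

text \<open>The maximal absolute row sum is submultiplicative and is at most 2 for \<open>B\<close>.
  Entries of powers thus grow at most geometrically, and the exponential series converges for every
  \<open>t\<close>.\<close>

lemma pow_row_abs: assumes "i < d" shows "(\<Sum>j<d. \<bar>(B ^\<^sub>m k) $$ (i, j)\<bar>) \<le> 2 ^ k"
proof (induction k)
  case 0
  have "(\<Sum>j<d. \<bar>(1\<^sub>m d :: real mat) $$ (i, j)\<bar>) = (\<Sum>j<d. if i = j then 1 else 0)"
    using assms by (intro sum.cong) auto
  then show ?case using assms by simp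
next
  case (Suc k)
  have "(\<Sum>j<d. \<bar>(B ^\<^sub>m Suc k) $$ (i, j)\<bar>)
      \<le> (\<Sum>j<d. \<Sum>l<d. \<bar>(B ^\<^sub>m k) $$ (i, l)\<bar> * \<bar>B $$ (l, j)\<bar>)"
    using assms by (intro sum_mono) (auto simp: pow_index_right simp flip: abs_mult simp del: pow_mat.simps)
  also have "\<dots> = (\<Sum>l<d. \<bar>(B ^\<^sub>m k) $$ (i, l)\<bar> * (\<Sum>j<d. \<bar>B $$ (l, j)\<bar>))"
    by (subst sum.swap) (simp add: sum_distrib_left)
  also have "\<dots> \<le> (\<Sum>l<d. \<bar>(B ^\<^sub>m k) $$ (i, l)\<bar> * 2)"
    by (intro sum_mono mult_left_mono B_row_abs) auto
  also have "\<dots> \<le> 2 ^ Suc k" using Suc by (simp flip: sum_distrib_right)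
  finally show ?case .
qed

lemma pow_index_abs: assumes "i < d" "j < d" shows "\<bar>(B ^\<^sub>m k) $$ (i, j)\<bar> \<le> 2 ^ k"
  using member_le_sum[of j "{..<d}" "\<lambda>j. \<bar>(B ^\<^sub>m k) $$ (i, j)\<bar>"] pow_row_abs[OF assms(1), of k] assms(2)
  by force

lemma smult_pow_index:
  assumes "i < d" "j < d"
  shows "((t \<cdot>\<^sub>m B) ^\<^sub>m k) $$ (i, j) = t ^ k * (B ^\<^sub>m k) $$ (i, j)"
  using assms
proof (induction k arbitrary: j)
  case 0
  then show ?case by simp
next
  case (Suc k)
  have "((t \<cdot>\<^sub>m B) ^\<^sub>m Suc k) $$ (i, j)
      = (\<Sum>l<d. ((t \<cdot>\<^sub>m B) ^\<^sub>m k) $$ (i, l) * (t \<cdot>\<^sub>m B) $$ (l, j))"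
    using Suc.prems by (simp only: pow_mat.simps)
      (intro index_mult_sum pow_carrier_mat smult_carrier_mat B_carrier)
  also have "\<dots> = (\<Sum>l<d. t ^ Suc k * ((B ^\<^sub>m k) $$ (i, l) * B $$ (l, j)))"
    using Suc by (intro sum.cong refl) simp
  also have "\<dots> = t ^ Suc k * (B ^\<^sub>m Suc k) $$ (i, j)"
    using Suc.prems by (simp only: pow_index_right sum_distrib_left)
  finally show ?case .
qed

lemma P_series:
  assumes "i < d" "j < d"
  shows "P t i j = (\<Sum>k. ((B ^\<^sub>m k) $$ (i, j) / fact k) * t ^ k)"
proof -
  show ?thesis
    using assms smult_pow_index[OF assms] unfolding P_def single_ball_kernel_def mat_exp_def by (simp add: B_def[symmetric] mult.commute)
qed

lemma summable_P:
  assumes "i < d" "j < d"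
  shows "summable (\<lambda>k. ((B ^\<^sub>m k) $$ (i, j) / fact k) * (t :: real) ^ k)"
proof (rule summable_comparison_test[OF _ summable_exp[of "2 * \<bar>t\<bar>"]], intro exI allI impI)
  fix k
  have "\<bar>(B ^\<^sub>m k) $$ (i, j)\<bar> * \<bar>t\<bar> ^ k / fact k \<le> 2 ^ k * \<bar>t\<bar> ^ k / fact k"
    using pow_index_abs[OF assms] by (intro divide_right_mono mult_right_mono) auto
  then show "norm ((B ^\<^sub>m k) $$ (i, j) / fact k * t ^ k) \<le> inverse (fact k) * (2 * \<bar>t\<bar>) ^ k"
    by (simp add: abs_mult power_abs power_mult_distrib field_simps)
qed

lemma P_deriv_series:
  assumes "i < d" "j < d"
  shows "((\<lambda>t. P t i j) has_real_derivative (\<Sum>k. ((B ^\<^sub>m Suc k) $$ (i, j) / fact k) * t ^ k)) (at t)"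
proof -
  have diffs: "diffs (\<lambda>k. (B ^\<^sub>m k) $$ (i, j) / fact k) = (\<lambda>k. (B ^\<^sub>m Suc k) $$ (i, j) / fact k)"
    by (rule ext, simp only: diffs_def fact_Suc) (simp add: field_simps del: pow_mat.simps of_nat_Suc)
  show ?thesis
    using termdiffs_strong_converges_everywhere[OF summable_P[OF assms], of t]
    unfolding diffs using assms by (simp add: P_series del: pow_mat.simps)
qed

text \<open>The forward equation P' = P B. It lets the derivative of \<open>X t v\<close> be
  absorbed into the vector \<open>v\<close>.\<close>

lemma P_deriv_right:
  assumes "i < d" "j < d"
  shows "((\<lambda>t. P t i j) has_real_derivative (\<Sum>l<d. P t i l * B $$ (l, j))) (at t)"
proof -
  have "(\<Sum>k. ((B ^\<^sub>m Suc k) $$ (i, j) / fact k) * t ^ k)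
      = (\<Sum>k. \<Sum>l<d. ((B ^\<^sub>m k) $$ (i, l) / fact k * t ^ k) * B $$ (l, j))"
    by (intro suminf_cong, subst pow_index_right[OF assms])
       (simp add: sum_divide_distrib sum_distrib_left sum_distrib_right mult_ac)
  also have "\<dots> = (\<Sum>l<d. \<Sum>k. ((B ^\<^sub>m k) $$ (i, l) / fact k * t ^ k) * B $$ (l, j))"
    using assms by (intro suminf_sum summable_mult2 summable_P) auto
  also have "\<dots> = (\<Sum>l<d. P t i l * B $$ (l, j))"
    using assms by (intro sum.cong refl) (simp only: P_series suminf_mult2[OF summable_P] lessThan_iff)
  finally show ?thesis using P_deriv_series[OF assms, of t] by (simp only:)
qed

text \<open>The backward equation P' = B P. It puts the generator outside, where the
  self-adjointness of a symmetric \<open>B\<close> can be used.\<close>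

lemma P_deriv_left:
  assumes "i < d" "j < d"
  shows "((\<lambda>t. P t i j) has_real_derivative (\<Sum>l<d. B $$ (i, l) * P t l j)) (at t)"
proof -
  have "(\<Sum>k. ((B ^\<^sub>m Suc k) $$ (i, j) / fact k) * t ^ k)
      = (\<Sum>k. \<Sum>l<d. B $$ (i, l) * ((B ^\<^sub>m k) $$ (l, j) / fact k * t ^ k))"
    by (intro suminf_cong, subst pow_index_left[OF assms])
       (simp add: sum_divide_distrib sum_distrib_left sum_distrib_right mult_ac)
  also have "\<dots> = (\<Sum>l<d. \<Sum>k. B $$ (i, l) * ((B ^\<^sub>m k) $$ (l, j) / fact k * t ^ k))"
    using assms by (intro suminf_sum summable_mult summable_P) auto
  also have "\<dots> = (\<Sum>l<d. B $$ (i, l) * P t l j)"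
    using assms by (intro sum.cong refl) (simp only: P_series suminf_mult[OF summable_P] lessThan_iff)
  finally show ?thesis using P_deriv_series[OF assms, of t] by (simp only:)
qed

lemma P_0: assumes "i < d" "j < d" shows "P 0 i j = (if i = j then 1 else 0)"
proof -
  have "P 0 i j = (B ^\<^sub>m 0) $$ (i, j)"
    using powser_zero[of "\<lambda>k. (B ^\<^sub>m k) $$ (i, j) / fact k"] assms
    by (simp only: P_series) simp
  then show ?thesis using assms B_carrier by auto
qed

text \<open>Rows of \<open>B\<close> sum to zero, so the row sums of \<open>P t\<close> are constant
  in \<open>t\<close> and equal those of the identity.\<close>

lemma P_row_sum: assumes "i < d" shows "(\<Sum>j<d. P t i j) = 1"
proof -
  have "((\<lambda>t. \<Sum>j<d. P t i j) has_real_derivative (\<Sum>j<d. \<Sum>l<d. P t i l * B $$ (l, j))) (at t)" for t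
    using assms by (intro DERIV_sum P_deriv_right) auto
  moreover have "(\<Sum>j<d. \<Sum>l<d. P t i l * B $$ (l, j)) = 0" for t
    by (subst sum.swap) (simp add: B_row_sum flip: sum_distrib_left)
  ultimately have "(\<Sum>j<d. P t i j) = (\<Sum>j<d. P 0 i j)"
    by (intro DERIV_isconst_all[where f = "\<lambda>t. \<Sum>j<d. P t i j"]) auto
  then show ?thesis using assms by (simp add: P_0)
qed


section \<open>Action of the matrix and of the heat kernel on complex vectors\<close>

definition L :: "(nat \<Rightarrow> complex) \<Rightarrow> nat \<Rightarrow> complex" where
  "L v i = (\<Sum>j<d. of_real (U $$ (i, j)) * v j)"

text \<open>Vectors are functions of which only the values below \<open>d\<close> matter. They are
  complex because a matrix that is not symmetric may have non-real eigenvalues.\<close>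

definition X :: "real \<Rightarrow> (nat \<Rightarrow> complex) \<Rightarrow> nat \<Rightarrow> complex" where
  "X t v i = (\<Sum>j<d. of_real (P t i j) * v j)"

lemma L_norm_le:
  assumes "\<And>j. j < d \<Longrightarrow> cmod (v j) \<le> M" "i < d"
  shows "cmod (L v i) \<le> M"
proof -
  have "cmod (L v i) \<le> (\<Sum>j<d. U $$ (i, j) * M)"
    unfolding L_def using assms nonneg
    by (intro sum_norm_le) (auto simp: norm_mult intro!: mult_left_mono)
  then show ?thesis using assms by (simp add: row_sum flip: sum_distrib_right)
qed

lemma L_sum: "(\<Sum>i<d. L v i) = (\<Sum>i<d. v i)"
proof -
  have "(\<Sum>i<d. L v i) = (\<Sum>j<d. of_real (\<Sum>i<d. U $$ (i, j)) * v j)"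
    unfolding L_def by (subst sum.swap) (simp add: sum_distrib_right)
  then show ?thesis by (simp add: col_sum)
qed

lemma B_sum:
  assumes "l < d"
  shows "(\<Sum>j<d. complex_of_real (B $$ (l, j)) * v j) = L v l - v l"
proof -
  have "(\<Sum>j<d. complex_of_real (B $$ (l, j)) * v j)
      = (\<Sum>j<d. of_real (U $$ (l, j)) * v j - (if l = j then v j else 0))"
    using assms by (intro sum.cong) (auto simp: B_index algebra_simps)
  then show ?thesis using assms by (simp add: sum_subtractf L_def)
qed

lemma X_deriv:
  assumes "i < d"
  shows "((\<lambda>t. X t v i) has_vector_derivative X t (\<lambda>j. L v j - v j) i) (at t)"
proof -
  have "((\<lambda>t. X t v i) has_vector_derivative
      (\<Sum>j<d. of_real (\<Sum>l<d. P t i l * B $$ (l, j)) * v j)) (at t)"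
    unfolding X_def using assms P_deriv_right
    by (intro has_vector_derivative_sum has_vector_derivative_mult_left has_vector_derivative_of_real) auto
  also have "(\<Sum>j<d. of_real (\<Sum>l<d. P t i l * B $$ (l, j)) * v j)
      = (\<Sum>l<d. of_real (P t i l) * (\<Sum>j<d. of_real (B $$ (l, j)) * v j))"
    by (simp add: sum_distrib_right sum_distrib_left mult.assoc) (rule sum.swap)
  also have "\<dots> = X t (\<lambda>j. L v j - v j) i"
    by (simp add: B_sum X_def)
  finally show ?thesis .
qed

lemma X_0: "i < d \<Longrightarrow> X 0 v i = v i"
  by (simp add: X_def P_0 if_distrib if_distribR cong: if_cong)

lemma X_lin: "X t (\<lambda>j. a * v j + b * w j) i = a * X t v i + b * X t w i"
  by (simp add: X_def sum.distrib sum_distrib_left algebra_simps)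

text \<open>Variation of constants for \<open>X' = (m - 1) X + X t (L v - m v)\<close>.\<close>

lemma X_integrating_factor:
  assumes "i < d"
  shows "((\<lambda>t. exp ((1 - m) * of_real t) * X t v i) has_vector_derivative
           exp ((1 - m) * of_real t) * X t (\<lambda>j. L v j - m * v j) i) (at t)"
proof -
  have "((\<lambda>t. exp ((1 - m) * of_real t)) has_vector_derivative (1 - m) * exp ((1 - m) * of_real t)) (at t)"
    by (rule has_vector_derivative_real_field) (auto intro!: derivative_eq_intros)
  from has_vector_derivative_mult[OF this X_deriv[OF assms]]
  have "((\<lambda>t. exp ((1 - m) * of_real t) * X t v i) has_vector_derivative
     exp ((1 - m) * of_real t) * X t (\<lambda>j. L v j - v j) i + (1 - m) * exp ((1 - m) * of_real t) * X t v i) (at t)" .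
  moreover have
    "exp ((1 - m) * of_real t) * X t (\<lambda>j. L v j - v j) i + (1 - m) * exp ((1 - m) * of_real t) * X t v i
      = exp ((1 - m) * of_real t) * X t (\<lambda>j. L v j - m * v j) i"
  proof -
    have "X t (\<lambda>j. L v j - m * v j) i = X t (\<lambda>j. L v j - v j) i + (1 - m) * X t v i"
      using X_lin[of t 1 "\<lambda>j. L v j - v j" "1 - m" v] by (simp add: algebra_simps)
    then show ?thesis by (simp only:) (simp add: ring_distribs mult_ac)
  qed
  ultimately show ?thesis by (simp only:)
qed

text \<open>Here \<open>L v - m v\<close> vanishes below \<open>d\<close>, so the product with the
  integrating factor is constant in time.\<close>

lemma X_eigenvector:
  assumes "\<And>j. j < d \<Longrightarrow> L v j = m * v j" "i < d"
  shows "X t v i = exp ((m - 1) * of_real t) * v i"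
proof -
  have "X s (\<lambda>j. L v j - m * v j) i = 0" for s
    using assms by (simp add: X_def)
  then have "((\<lambda>t. exp ((1 - m) * of_real t) * X t v i) has_vector_derivative 0) (at s within UNIV)" for s
    using X_integrating_factor[OF assms(2), of m v s] by simp
  from has_vector_derivative_zero_constant[OF convex_UNIV this]
  obtain c where "\<And>t. exp ((1 - m) * of_real t) * X t v i = c" by auto
  from this[of t] this[of 0] have "exp ((1 - m) * of_real t) * X t v i = v i"
    using assms by (simp add: X_0)
  then have "exp ((m - 1) * of_real t) * (exp ((1 - m) * of_real t) * X t v i) = exp ((m - 1) * of_real t) * v i"
    by simp
  moreover have "exp ((m - 1) * of_real t) * exp ((1 - m) * of_real t) = 1"
    by (subst exp_add[symmetric]) (simp add: algebra_simps)
  ultimately show ?thesis by (simp only: mult.assoc[symmetric] mult_1_left)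
qed

text \<open>The product of the operators L - m over the list, applied to \<open>v\<close>. The head
  acts first, so that induction on the list replaces \<open>v\<close> by the shifted vector.\<close>

primrec shifts :: "complex list \<Rightarrow> (nat \<Rightarrow> complex) \<Rightarrow> nat \<Rightarrow> complex" where
  "shifts [] v = v"
| "shifts (m # ms) v = shifts ms (\<lambda>i. L v i - m * v i)"

text \<open>Induction on the list. The shifted vector is bounded by \<open>2 * M\<close>, has one
  factor less and decays by the induction hypothesis; integrating its bound from 0 to
  \<open>t\<close> recovers \<open>X t v\<close> and costs one more factor of order
  \<open>t\<close>.\<close>

lemma X_decay:
  assumes "\<And>m. m \<in> set ms \<Longrightarrow> Re m \<le> 1 - g \<and> cmod m \<le> 1"
    and "\<And>j. j < d \<Longrightarrow> shifts ms v j = 0"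
    and "\<And>j. j < d \<Longrightarrow> cmod (v j) \<le> M"
    and "0 \<le> t" "i < d"
  shows "cmod (X t v i) \<le> M * (2 ^ length ms - 1) * (1 + t) ^ length ms * exp (- g * t)"
  using assms
proof (induction ms arbitrary: v M t)
  case Nil
  then show ?case by (simp add: X_def)
next
  case (Cons m ms)
  define k where "k = length ms"
  define e where "e s = exp ((1 - m) * of_real s)" for s
  have norm_e: "cmod (e s) = exp ((1 - Re m) * s)" for s
    by (simp add: e_def norm_exp_eq_Re)
  have M: "0 \<le> M" using Cons.prems(3,5) norm_ge_zero order_trans by blast
  have m: "Re m \<le> 1 - g" "cmod m \<le> 1" using Cons.prems(1) by auto
  have exp_split: "exp ((1 - Re m - g) * s) = exp ((1 - Re m) * s) * exp (- g * s)" for s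
    by (subst exp_add[symmetric]) (simp add: algebra_simps)
  \<comment> \<open>This is the constant of the induction hypothesis for \<open>2 * M\<close>, with
    1 + s enlarged to 1 + t so that it serves for all times up to \<open>t\<close>.\<close>
  define K where "K = 2 * M * (2 ^ k - 1) * (1 + t) ^ k"
  have K: "0 \<le> K" using M Cons.prems(4) by (simp add: K_def)
  have "cmod (L v j - m * v j) \<le> 2 * M" if "j < d" for j
  proof -
    have "cmod (L v j) \<le> M" using L_norm_le[of v M j] Cons.prems(3) that by blast
    moreover have "cmod (m * v j) \<le> 1 * M"
      unfolding norm_mult using m Cons.prems(3)[OF that] by (intro mult_mono) auto
    ultimately show ?thesis using norm_triangle_ineq4[of "L v j" "m * v j"] by simp
  qed
  then have IH: "cmod (X s (\<lambda>j. L v j - m * v j) i) \<le> K * exp (- g * s)" if "0 \<le> s" "s \<le> t" for s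
  proof -
    assume "\<And>j. j < d \<Longrightarrow> cmod (L v j - m * v j) \<le> 2 * M"
    then have "cmod (X s (\<lambda>j. L v j - m * v j) i) \<le> 2 * M * (2 ^ k - 1) * (1 + s) ^ k * exp (- g * s)"
      unfolding k_def using Cons.prems that by (intro Cons.IH) auto
    also have "\<dots> \<le> K * exp (- g * s)"
      unfolding K_def using that M by (intro mult_right_mono mult_left_mono power_mono) auto
    finally show ?thesis .
  qed
  have bound: "cmod (e t * X t v i - v i) \<le> t * (K * exp ((1 - Re m - g) * t))"
  proof (cases "t = 0")
    case True
    then show ?thesis using Cons.prems by (simp add: X_0 e_def)
  next
    case False
    then have "0 < t" using Cons.prems by simp
    \<comment> \<open>The exponent 1 - Re m - g is nonnegative, so the bound on the derivative is
      largest at time \<open>t\<close>.\<close>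
    define c where "c = K * exp ((1 - Re m - g) * t)"
    have deriv: "((\<lambda>s. e s * X s v i) has_vector_derivative e s * X s (\<lambda>j. L v j - m * v j) i) (at s)" for s
      unfolding e_def by (rule X_integrating_factor[OF Cons.prems(5)])
    have "norm (e t * X t v i - e 0 * X 0 v i) \<le> t * c - 0 * c"
    proof (rule differentiable_bound_general[OF \<open>0 < t\<close>])
      show "continuous_on {0..t} (\<lambda>s. e s * X s v i)"
        by (intro continuous_at_imp_continuous_on ballI has_vector_derivative_continuous[OF deriv])
      show "((\<lambda>s. s * c) has_vector_derivative c) (at s)" for s
        by (auto intro!: derivative_eq_intros simp: has_real_derivative_iff_has_vector_derivative[symmetric])
      fix s assume s: "0 < s" "s < t"
      have "cmod (e s * X s (\<lambda>j. L v j - m * v j) i) \<le> exp ((1 - Re m) * s) * (K * exp (- g * s))"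
        unfolding norm_mult norm_e using s IH[of s] by (intro mult_left_mono) auto
      also have "\<dots> = K * exp ((1 - Re m - g) * s)"
        by (simp add: exp_split)
      also have "\<dots> \<le> c"
        unfolding c_def using m s K by (intro mult_left_mono) (auto intro!: mult_left_mono)
      finally show "norm (e s * X s (\<lambda>j. L v j - m * v j) i) \<le> c" .
    qed (auto intro!: deriv continuous_intros)
    then show ?thesis using Cons.prems by (simp add: X_0 e_def c_def)
  qed
  have "exp ((1 - Re m) * t) * cmod (X t v i) \<le> M + t * (K * exp ((1 - Re m - g) * t))"
    using bound norm_triangle_ineq2[of "e t * X t v i" "v i"] Cons.prems(3)[OF Cons.prems(5)]
    by (simp add: norm_mult norm_e)
  also have "\<dots> \<le> M * exp ((1 - Re m - g) * t) + t * (K * exp ((1 - Re m - g) * t))"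
  proof -
    have "0 \<le> (1 - Re m - g) * t"
      using m Cons.prems(4) by (intro mult_nonneg_nonneg) auto
    then have "1 \<le> exp ((1 - Re m - g) * t)" by simp
    from mult_left_mono[OF this M] show ?thesis by simp
  qed
  also have "\<dots> = (M + t * K) * exp ((1 - Re m - g) * t)" by (simp add: algebra_simps)
  also have "\<dots> = exp ((1 - Re m) * t) * ((M + t * K) * exp (- g * t))"
    by (simp add: exp_split)
  finally have "cmod (X t v i) \<le> (M + t * K) * exp (- g * t)" by simp
  \<comment> \<open>The coefficient closes up because 1 + 2 * (2 ^ k - 1) = 2 ^ Suc k - 1.\<close>
  also have "\<dots> \<le> (M * (2 ^ Suc k - 1) * (1 + t) ^ Suc k) * exp (- g * t)"
  proof (intro mult_right_mono)
    have "M * 1 \<le> M * (1 + t) ^ Suc k"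
      using M Cons.prems by (intro mult_left_mono one_le_power) auto
    moreover have "t * K \<le> (1 + t) * K" using K by (intro mult_right_mono) auto
    ultimately show "M + t * K \<le> M * (2 ^ Suc k - 1) * (1 + t) ^ Suc k"
      by (simp add: K_def algebra_simps)
  qed auto
  finally show ?case by (simp add: k_def)
qed


subsection \<open>Annihilating polynomials and the spectral gap\<close>

lemma U_dim [simp]: "dim_row U = d" "dim_col U = d"
  using carrier by (simp_all only: carrier_matD)

lemma L_cong: "(\<And>j. j < d \<Longrightarrow> v j = w j) \<Longrightarrow> L v i = L w i"
  by (simp add: L_def)

lemma L_lin: "L (\<lambda>j. a * v j - b * w j) i = a * L v i - b * L w i"
  by (simp add: L_def sum_subtractf sum_distrib_left algebra_simps)

lemma L_sum_lin: "L (\<lambda>j. \<Sum>k\<in>S. c k * w k j) i = (\<Sum>k\<in>S. c k * L (w k) i)"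
  by (simp add: L_def sum_distrib_left sum_distrib_right mult_ac) (rule sum.swap)

definition poly_op :: "complex poly \<Rightarrow> (nat \<Rightarrow> complex) \<Rightarrow> nat \<Rightarrow> complex" where
  "poly_op p v i = (\<Sum>k\<le>degree p. coeff p k * (L ^^ k) v i)"

lemma poly_op_bound: "degree p \<le> N \<Longrightarrow> poly_op p v i = (\<Sum>k\<le>N. coeff p k * (L ^^ k) v i)"
  unfolding poly_op_def by (intro sum.mono_neutral_left) (auto simp: coeff_eq_0)

lemma poly_op_linear_factor: "poly_op ([:-a, 1:] * q) v i = L (poly_op q v) i - a * poly_op q v i"
proof -
  define N where "N = degree q"
  have deg: "degree ([:-a, 1:] * q) \<le> Suc N"
    unfolding N_def using degree_mult_le[of "[:-a, 1:]" q] by simp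
  have "poly_op ([:-a, 1:] * q) v i = (\<Sum>k\<le>Suc N. coeff ([:-a, 1:] * q) k * (L ^^ k) v i)"
    by (rule poly_op_bound[OF deg])
  also have "\<dots> = (\<Sum>k\<le>Suc N. coeff (pCons 0 q) k * (L ^^ k) v i - a * (coeff q k * (L ^^ k) v i))"
    by (intro sum.cong refl) (simp add: algebra_simps)
  also have "\<dots> = (\<Sum>k\<le>Suc N. coeff (pCons 0 q) k * (L ^^ k) v i) - a * poly_op q v i"
    by (subst poly_op_bound[of q "Suc N"]) (simp_all only: N_def le_SucI sum_subtractf sum_distrib_left)
  also have "(\<Sum>k\<le>Suc N. coeff (pCons 0 q) k * (L ^^ k) v i) = (\<Sum>k\<le>N. coeff q k * (L ^^ Suc k) v i)"
    by (subst sum.atMost_Suc_shift) simp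
  also have "\<dots> = L (poly_op q v) i"
    unfolding poly_op_def N_def by (simp add: L_sum_lin)
  finally show ?thesis .
qed

lemma L_pow_shift: "(L ^^ k) (\<lambda>i. L v i - a * v i) = (\<lambda>i. (L ^^ Suc k) v i - a * (L ^^ k) v i)"
proof (induction k)
  case (Suc k)
  show ?case
    using L_lin[of 1 "(L ^^ Suc k) v" a "(L ^^ k) v"] by (simp add: Suc fun_eq_iff)
qed simp

text \<open>The same value as in \<open>poly_op_linear_factor\<close>, so L - a may act before or
  after \<open>q\<close>. This identifies a factored polynomial with \<open>shifts\<close>, in which
  the head of the list acts first.\<close>

lemma poly_op_shift: "poly_op q (\<lambda>i. L v i - a * v i) i = L (poly_op q v) i - a * poly_op q v i"
  unfolding poly_op_def by (simp add: L_pow_shift L_sum_lin sum_subtractf sum_distrib_left algebra_simps)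

lemma poly_op_prod_list: "poly_op (\<Prod>a\<leftarrow>as. [:-a, 1:]) v i = shifts as v i"
proof (induction as arbitrary: v)
  case Nil
  then show ?case by (simp add: poly_op_def)
next
  case (Cons a as)
  have "poly_op (\<Prod>a\<leftarrow>a # as. [:-a, 1:]) v i = poly_op ([:-a, 1:] * (\<Prod>a\<leftarrow>as. [:-a, 1:])) v i"
    by simp
  also have "\<dots> = poly_op (\<Prod>a\<leftarrow>as. [:-a, 1:]) (\<lambda>i. L v i - a * v i) i"
    unfolding poly_op_linear_factor poly_op_shift ..
  also have "\<dots> = shifts (a # as) v i" by (simp only: Cons shifts.simps)
  finally show ?case .
qed

lemma poly_op_smult: "poly_op (Polynomial.smult c p) v i = c * poly_op p v i"
  by (subst poly_op_bound[of "Polynomial.smult c p" "degree p"])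
     (simp_all add: poly_op_def sum_distrib_left mult.assoc degree_smult_le)

lemma L_pow_sum: "(\<Sum>i<d. (L ^^ k) v i) = (\<Sum>i<d. v i)"
  by (induction k) (simp_all add: L_sum)

text \<open>Column sums equal to one make \<open>L\<close>, hence each of its powers, preserve the
  sum.\<close>

lemma poly_op_sum:
  assumes "(\<Sum>i<d. v i) = 0"
  shows "(\<Sum>i<d. poly_op p v i) = 0"
  unfolding poly_op_def by (subst sum.swap) (simp add: L_pow_sum assms flip: sum_distrib_left)

text \<open>The d + 1 vectors v, L v, ..., L^d v live in dimension d, so they are dependent; the
  coefficients of a dependency form the polynomial.\<close>

lemma annihilating_poly:
  obtains p where "p \<noteq> 0" "degree p \<le> d" "\<And>i. i < d \<Longrightarrow> poly_op p v i = 0"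
proof -
  \<comment> \<open>Column \<open>k\<close> holds the k-th iterate. The additional zero row
    \<open>d\<close> makes the matrix square and singular, so that the determinant criterion
    supplies a kernel vector.\<close>
  define A where "A = Matrix.mat (Suc d) (Suc d) (\<lambda>(i, k). if i < d then (L ^^ k) v i else 0)"
  have A: "A \<in> carrier_mat (Suc d) (Suc d)" by (simp add: A_def)
  have "transpose_mat A *\<^sub>v unit_vec (Suc d) d = 0\<^sub>v (Suc d)"
    by (intro eq_vecI) (auto simp: A_def)
  moreover have "unit_vec (Suc d) d \<noteq> (0\<^sub>v (Suc d) :: complex Matrix.vec)" by simp
  ultimately have "Determinant.det (transpose_mat A) = 0"
    using det_0_iff_vec_prod_zero[of "transpose_mat A" "Suc d"] A unit_vec_carrier[of "Suc d" d]
    by (metis transpose_carrier_mat)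
  then have "Determinant.det A = 0" using Determinant.det_transpose[OF A] by simp
  then obtain c where c: "c \<in> carrier_vec (Suc d)" "c \<noteq> 0\<^sub>v (Suc d)" "A *\<^sub>v c = 0\<^sub>v (Suc d)"
    using det_0_iff_vec_prod_zero[OF A] by blast
  define p where "p = (\<Sum>k\<le>d. monom (vec_index c k) k)"
  have coeff: "coeff p k = (if k \<le> d then vec_index c k else 0)" for k
    by (simp add: p_def coeff_sum)
  have deg: "degree p \<le> d" by (intro degree_le) (simp add: coeff)
  show thesis
  proof
    show "p \<noteq> 0"
    proof
      assume "p = 0"
      then have "vec_index c k = 0" if "k \<le> d" for k using coeff[of k] that by simp
      then have "c = 0\<^sub>v (Suc d)" using c(1) by (intro eq_vecI) auto
      then show False using c(2) by simp
    qed
    show "degree p \<le> d" by (rule deg)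
    fix i assume i: "i < d"
    have "poly_op p v i = (\<Sum>k\<le>d. vec_index c k * (L ^^ k) v i)"
      unfolding poly_op_bound[OF deg] by (simp add: coeff)
    also have "\<dots> = vec_index (A *\<^sub>v c) i"
      using i c(1) by (auto simp: A_def scalar_prod_def mult.commute atLeast0AtMost[symmetric]
        atLeastLessThanSuc_atLeastAtMost intro!: sum.cong)
    also have "\<dots> = 0" using i by (simp add: c(3))
    finally show "poly_op p v i = 0" .
  qed
qed

text \<open>For an annihilating polynomial of least degree, dividing out a root \<open>a\<close>
  leaves \<open>q\<close> with q(L) v nonzero, while (L - a) q(L) v = 0. So
  \<open>poly_op q v\<close> is an eigenvector for \<open>a\<close>, and its sum is zero because
  that of \<open>v\<close> is.\<close>

lemma annihilating_eigenvalues: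
  assumes "(\<Sum>i<d. v i) = 0"
  shows "\<exists>as. length as \<le> d \<and> (\<forall>i<d. shifts as v i = 0)
    \<and> (\<forall>a\<in>set as. \<exists>w. (\<forall>i<d. L w i = a * w i) \<and> (\<Sum>i<d. w i) = 0 \<and> (\<exists>i<d. w i \<noteq> 0))"
proof -
  define Q where "Q p \<longleftrightarrow> p \<noteq> 0 \<and> (\<forall>i<d. poly_op p v i = 0)" for p
  obtain p0 where p0: "Q p0" "degree p0 \<le> d" using annihilating_poly unfolding Q_def by metis
  obtain p where p: "Q p" and min: "\<And>q. Q q \<Longrightarrow> degree p \<le> degree q"
    using ex_has_least_nat[of Q p0 degree] p0(1) by blast
  obtain as where as: "length as = degree p" "p = Polynomial.smult (lead_coeff p) (\<Prod>a\<leftarrow>as. [:-a, 1:])"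
  proof -
    obtain A where A: "size A = degree p" "p = Polynomial.smult (lead_coeff p) (\<Prod>x\<in>#A. [:-x, 1:])"
      using alg_closed_imp_factorization[of p] p by (auto simp: Q_def)
    obtain as where "mset as = A" using ex_mset by blast
    then show thesis using A that[of as] by (auto simp: mset_map[symmetric] prod_mset_prod_list simp del: mset_map)
  qed
  show ?thesis
  proof (rule exI[of _ as], intro conjI allI impI ballI)
    show "length as \<le> d" using as(1) min[OF p0(1)] p0(2) by simp
    show "shifts as v i = 0" if "i < d" for i
    proof -
      have "lead_coeff p * shifts as v i = poly_op p v i"
        by (subst as(2), subst poly_op_smult, subst poly_op_prod_list) simp
      then show ?thesis using p that by (simp add: Q_def)
    qed
    fix a assume a: "a \<in> set as"
    have "[:-a, 1:] dvd (\<Prod>a\<leftarrow>as. [:-a, 1:])"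
    proof -
      obtain ys zs where "as = ys @ a # zs" using split_list[OF a] by blast
      then have "(\<Prod>a\<leftarrow>as. [:-a, 1:]) = [:-a, 1:] * ((\<Prod>a\<leftarrow>ys. [:-a, 1:]) * (\<Prod>a\<leftarrow>zs. [:-a, 1:]))"
        by (simp only: map_append list.map prod_list.append prod_list.Cons mult.left_commute)
      then show ?thesis by (rule dvdI)
    qed
    then have "[:-a, 1:] dvd p" by (subst as(2)) (rule dvd_smult)
    then obtain q where q: "p = [:-a, 1:] * q" by (elim dvdE)
    have "q \<noteq> 0" using p q by (auto simp: Q_def)
    then have "degree p = Suc (degree q)" unfolding q by (subst degree_mult_eq) auto
    then have "\<not> Q q" using min[of q] by auto
    then have "\<exists>i<d. poly_op q v i \<noteq> 0" using \<open>q \<noteq> 0\<close> by (auto simp: Q_def)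
    moreover have "\<forall>i<d. L (poly_op q v) i = a * poly_op q v i"
      using p unfolding Q_def by (simp only: q poly_op_linear_factor eq_iff_diff_eq_0[symmetric]) simp
    ultimately show "\<exists>w. (\<forall>i<d. L w i = a * w i) \<and> (\<Sum>i<d. w i) = 0 \<and> (\<exists>i<d. w i \<noteq> 0)"
      using poly_op_sum[OF assms] by blast
  qed
qed

section \<open>The spectral gap as a minimum over non-constant eigenfunctions\<close>

definition gap :: real where "gap = spectral_gap d U"

definition nonconst_eigen :: "complex \<Rightarrow> (nat \<Rightarrow> complex) \<Rightarrow> bool" where
  "nonconst_eigen l w \<longleftrightarrow> (\<forall>i<d. L w i = l * w i) \<and> (\<exists>i<d. \<exists>j<d. w i \<noteq> w j)"

lemma nonconst_of_sum_zero:
  assumes "(\<Sum>i<d. w i) = 0" "\<exists>i<d. w i \<noteq> (0 :: complex)"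
  shows "\<exists>i<d. \<exists>j<d. w i \<noteq> w j"
proof (rule ccontr)
  assume const: "\<not> ?thesis"
  obtain i where i: "i < d" "w i \<noteq> 0" using assms by blast
  have "(\<Sum>j<d. w j) = (\<Sum>j<d. w i)"
  proof (intro sum.cong refl)
    fix j assume "j \<in> {..<d}"
    then show "w j = w i" using const i(1) by blast
  qed
  then show False using assms i by simp
qed

lemma mult_vec_index:
  assumes "v \<in> carrier_vec d" "i < d"
  shows "vec_index (map_mat complex_of_real U *\<^sub>v v) i = L (vec_index v) i"
  using assms carrier by (auto simp: L_def scalar_prod_def lessThan_atLeast0 intro!: sum.cong)

text \<open>Passes between eigenvectors of the matrix type and eigenfunctions of \<open>L\<close>. A
  non-constant function is not zero, so the requirement that an eigenvector be nonzero is
  met.\<close>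

lemma gap_set:
  "{1 - Re l | l. \<exists>v. eigenvector (map_mat complex_of_real U) v l
      \<and> (\<exists>i<d. \<exists>j<d. vec_index v i \<noteq> vec_index v j)} = {1 - Re l | l. \<exists>w. nonconst_eigen l w}"
proof -
  have "(\<exists>v. eigenvector (map_mat complex_of_real U) v l
      \<and> (\<exists>i<d. \<exists>j<d. vec_index v i \<noteq> vec_index v j)) \<longleftrightarrow> (\<exists>w. nonconst_eigen l w)" (is "?l \<longleftrightarrow> ?r") for l
  proof
    assume ?l
    then obtain v where v: "eigenvector (map_mat complex_of_real U) v l"
      "\<exists>i<d. \<exists>j<d. vec_index v i \<noteq> vec_index v j" by blast
    then have c: "v \<in> carrier_vec d" and e: "map_mat complex_of_real U *\<^sub>v v = l \<cdot>\<^sub>v v"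
      using carrier by (auto simp: eigenvector_def)
    have "L (vec_index v) i = l * vec_index v i" if "i < d" for i
      using mult_vec_index[OF c that] c that by (simp add: e)
    then show ?r using v by (auto simp: nonconst_eigen_def)
  next
    assume ?r
    then obtain w where w: "nonconst_eigen l w" by blast
    define v where "v = Matrix.vec d w"
    have c: "v \<in> carrier_vec d" by (simp add: v_def)
    have "L (vec_index v) i = l * vec_index v i" if "i < d" for i
      using w that L_cong[of "vec_index v" w i] by (simp add: v_def nonconst_eigen_def)
    then have "map_mat complex_of_real U *\<^sub>v v = l \<cdot>\<^sub>v v"
      using c carrier by (intro eq_vecI) (auto simp: mult_vec_index simp del: index_mult_mat_vec)
    moreover have "\<exists>i<d. \<exists>j<d. vec_index v i \<noteq> vec_index v j"
      using w unfolding nonconst_eigen_def v_def by (metis index_vec)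
    moreover from this have "v \<noteq> 0\<^sub>v d" by auto
    ultimately show ?l using c carrier by (auto simp: eigenvector_def)
  qed
  then show ?thesis by simp
qed

text \<open>The eigenvalues are roots of the characteristic polynomial. Finiteness is what makes
  \<open>Min\<close> in the spectral gap a true minimum.\<close>

lemma finite_gap_set: "finite {1 - Re l | l. \<exists>w. nonconst_eigen l w}"
proof -
  have "{1 - Re l | l. \<exists>w. nonconst_eigen l w} \<subseteq> (\<lambda>l. 1 - Re l) ` {l. poly (char_poly (map_mat complex_of_real U)) l = 0}"
    unfolding gap_set[symmetric] using carrier
    by (auto simp: eigenvalue_root_char_poly[of _ d, symmetric] eigenvalue_def)
  moreover have "finite {l. poly (char_poly (map_mat complex_of_real U)) l = 0}"
    using carrier degree_monic_char_poly[of "map_mat complex_of_real U" d]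
    by (intro poly_roots_finite) auto
  ultimately show ?thesis using finite_surj by blast
qed

lemma gap_le: "nonconst_eigen l w \<Longrightarrow> gap \<le> 1 - Re l"
  unfolding gap_def spectral_gap_def gap_set by (rule Min_le[OF finite_gap_set]) auto

lemma nonconst_eigen_of_sum_zero:
  assumes "\<forall>i<d. L w i = l * w i" "(\<Sum>i<d. w i) = 0" "\<exists>i<d. w i \<noteq> 0"
  shows "nonconst_eigen l w"
  using assms nonconst_of_sum_zero[of w] by (auto simp: nonconst_eigen_def)

text \<open>A finite set attains its minimum once it is nonempty, so a single non-constant
  eigenfunction has to be produced.\<close>

lemma gap_attained:
  assumes "d \<ge> 2"
  obtains l w where "nonconst_eigen l w" "gap = 1 - Re l"
proof -
  \<comment> \<open>A nonzero vector of sum zero, available as soon as there are two states.\<close>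
  define v :: "nat \<Rightarrow> complex" where "v i = (if i = 0 then 1 else if i = 1 then -1 else 0)" for i
  have "(\<Sum>i<d. v i) = (\<Sum>i\<in>{0,1}. v i)"
    using assms by (intro sum.mono_neutral_right) (auto simp: v_def)
  then have "(\<Sum>i<d. v i) = 0" by (simp add: v_def)
  from annihilating_eigenvalues[OF this] obtain as where as: "length as \<le> d \<and> (\<forall>i<d. shifts as v i = 0)
    \<and> (\<forall>a\<in>set as. \<exists>w. (\<forall>i<d. L w i = a * w i) \<and> (\<Sum>i<d. w i) = 0 \<and> (\<exists>i<d. w i \<noteq> 0))" ..
  have "shifts as v 0 = 0" using as assms by simp
  \<comment> \<open>An empty list would leave \<open>v\<close> unchanged, but
    \<open>v 0 = 1\<close>. The head of the list is then an eigenvalue of the required kind.\<close>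
  then have "as \<noteq> []" by (auto simp: v_def)
  then have "hd as \<in> set as" by simp
  then have "{1 - Re l | l. \<exists>w. nonconst_eigen l w} \<noteq> {}"
    using as nonconst_eigen_of_sum_zero by blast
  from Min_in[OF finite_gap_set this] show thesis
    using that unfolding gap_def spectral_gap_def gap_set by blast
qed

text \<open>Evaluate the eigenvalue equation at an index where the modulus of \<open>w\<close> is
  maximal; \<open>L\<close> cannot increase that maximum.\<close>

lemma eigenvalue_norm_le:
  assumes "\<forall>i<d. L w i = l * w i" "\<exists>i<d. w i \<noteq> 0"
  shows "cmod l \<le> 1"
proof -
  define M where "M = Max ((\<lambda>i. cmod (w i)) ` {..<d})"
  have ne: "{..<d} \<noteq> {}" using assms by auto
  have le: "cmod (w i) \<le> M" if "i < d" for i unfolding M_def using that by (intro Max_ge) auto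
  have "M \<in> (\<lambda>i. cmod (w i)) ` {..<d}" unfolding M_def using ne by (intro Max_in) auto
  then obtain i where i: "i < d" "cmod (w i) = M" by auto
  have "0 < M" using assms(2) le by (metis zero_less_norm_iff order_less_le_trans)
  have "cmod l * M \<le> M" using L_norm_le[of w M i] le i assms(1) by (simp add: norm_mult)
  then show ?thesis using \<open>0 < M\<close> by simp
qed

text \<open>Every shift in the annihilating list is an eigenvalue with a non-constant eigenfunction,
  so the gap controls its real part; at most \<open>d\<close> shifts occur.\<close>

lemma X_decay_gap:
  assumes "(\<Sum>i<d. v i) = 0" "\<And>j. j < d \<Longrightarrow> cmod (v j) \<le> M" "0 \<le> t" "i < d"
  shows "cmod (X t v i) \<le> M * 2 ^ d * (1 + t) ^ d * exp (- gap * t)"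
proof -
  from annihilating_eigenvalues[OF assms(1)] obtain as where as: "length as \<le> d \<and> (\<forall>i<d. shifts as v i = 0)
    \<and> (\<forall>a\<in>set as. \<exists>w. (\<forall>i<d. L w i = a * w i) \<and> (\<Sum>i<d. w i) = 0 \<and> (\<exists>i<d. w i \<noteq> 0))" ..
  then have len: "length as \<le> d" by simp
  have M: "0 \<le> M" using assms(2,4) norm_ge_zero order_trans by blast
  have bnd: "Re a \<le> 1 - gap \<and> cmod a \<le> 1" if "a \<in> set as" for a
  proof -
    from bspec[OF conjunct2[OF conjunct2[OF as]] that]
    obtain w where w: "(\<forall>i<d. L w i = a * w i) \<and> (\<Sum>i<d. w i) = 0 \<and> (\<exists>i<d. w i \<noteq> 0)" ..
    then have "nonconst_eigen a w" by (intro nonconst_eigen_of_sum_zero) simp_all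
    moreover have "cmod a \<le> 1" using w by (intro eigenvalue_norm_le[of w]) simp_all
    ultimately show ?thesis using gap_le[of a w] by simp
  qed
  have "shifts as v j = 0" if "j < d" for j using as that by blast
  from X_decay[OF bnd this assms(2-4)]
  have "cmod (X t v i) \<le> M * (2 ^ length as - 1) * (1 + t) ^ length as * exp (- gap * t)"
    by simp
  also have "\<dots> \<le> M * 2 ^ d * (1 + t) ^ d * exp (- gap * t)"
  proof -
    have "(2::real) ^ length as \<le> 2 ^ d" by (rule power_increasing[OF len]) simp
    then have "(2::real) ^ length as - 1 \<le> 2 ^ d" by linarith
    moreover have "(1 + t) ^ length as \<le> (1 + t) ^ d"
      using assms by (intro power_increasing[OF len]) simp
    ultimately show ?thesis using M assms by (intro mult_right_mono mult_mono mult_left_mono) auto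
  qed
  finally show ?thesis .
qed

end

lemma prob_uniform_dist:
  assumes "0 < d" "A \<subseteq> {..<d}"
  shows "measure_pmf.prob (uniform_dist d) A = card A / d"
  using assms unfolding uniform_dist_def by (subst measure_pmf_of_set) (auto simp: Int_absorb1)

lemma pmf_uniform_dist: "x < d \<Longrightarrow> pmf (uniform_dist d) x = 1 / d"
  unfolding uniform_dist_def by (subst pmf_of_set) auto

context doubly_stochastic
begin

subsection \<open>The gap and the Cheeger constant\<close>

text \<open>The Cheeger numerator without the weight 1 / d, which cancels against the same weight in
  the measure of \<open>A\<close>.\<close>

definition flow :: "nat set \<Rightarrow> real" where
  "flow A = (\<Sum>x\<in>A. \<Sum>y\<in>{..<d} - A. U $$ (x, y))"

lemma flow_nonneg: "A \<subseteq> {..<d} \<Longrightarrow> 0 \<le> flow A"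
  unfolding flow_def by (intro sum_nonneg nonneg) auto

text \<open>The rows indexed by \<open>A\<close> and the columns indexed by \<open>A\<close> both
  have total mass \<open>card A\<close>. Removing the common block leaves the outflow and the
  inflow.\<close>

lemma flow_compl:
  assumes "A \<subseteq> {..<d}"
  shows "flow ({..<d} - A) = flow A"
proof -
  have fin: "finite A" using assms finite_subset by blast
  have split: "(\<Sum>y<d. f y) = (\<Sum>y\<in>A. f y) + (\<Sum>y\<in>{..<d} - A. f y)" for f :: "nat \<Rightarrow> real"
    using sum.subset_diff[of A "{..<d}" f] assms by simp
  have "(\<Sum>x\<in>A. \<Sum>y\<in>A. U $$ (x, y)) + flow A = (\<Sum>x\<in>A. \<Sum>y<d. U $$ (x, y))"
    unfolding flow_def split by (simp add: sum.distrib)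
  also have "\<dots> = card A" using assms by (simp add: row_sum subset_iff)
  also have "\<dots> = (\<Sum>y\<in>A. \<Sum>x<d. U $$ (x, y))" using assms by (simp add: col_sum subset_iff)
  also have "\<dots> = (\<Sum>y\<in>A. \<Sum>x\<in>A. U $$ (x, y)) + (\<Sum>y\<in>A. \<Sum>x\<in>{..<d} - A. U $$ (x, y))"
    unfolding split by (simp add: sum.distrib)
  also have "(\<Sum>y\<in>A. \<Sum>x\<in>{..<d} - A. U $$ (x, y)) = flow ({..<d} - A)"
    unfolding flow_def using assms by (subst sum.swap) (simp add: double_diff)
  also have "(\<Sum>y\<in>A. \<Sum>x\<in>A. U $$ (x, y)) = (\<Sum>x\<in>A. \<Sum>y\<in>A. U $$ (x, y))"
    by (rule sum.swap)
  finally show ?thesis by simp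
qed

lemma cheeger_eq:
  assumes "0 < d"
  shows "cheeger_constant d U = Min ((\<lambda>A. flow A / card A) ` {A. A \<subseteq> {..<d} \<and> A \<noteq> {} \<and> 2 * card A \<le> d})"
proof -
  have "{A. A \<subseteq> {..<d} \<and> 0 < measure_pmf.prob (uniform_dist d) A \<and> measure_pmf.prob (uniform_dist d) A \<le> 1 / 2}
     = {A. A \<subseteq> {..<d} \<and> A \<noteq> {} \<and> 2 * card A \<le> d}"
  proof (intro Collect_cong conj_cong refl)
    fix A assume A: "A \<subseteq> {..<d}"
    then have "finite A" using finite_subset by blast
    then show "(0 < measure_pmf.prob (uniform_dist d) A) = (A \<noteq> {})"
      using assms A by (simp add: prob_uniform_dist card_gt_0_iff zero_less_divide_iff)
    have "real (card A) / real d \<le> 1 / 2 \<longleftrightarrow> real (2 * card A) \<le> real d"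
      using assms by (simp add: field_simps)
    then show "(measure_pmf.prob (uniform_dist d) A \<le> 1 / 2) = (2 * card A \<le> d)"
      unfolding prob_uniform_dist[OF assms A] of_nat_le_iff .
  qed
  moreover have "(\<Sum>x\<in>A. \<Sum>y\<in>{..<d} - A. pmf (uniform_dist d) x * U $$ (x, y))
               / measure_pmf.prob (uniform_dist d) A = flow A / card A" if "A \<subseteq> {..<d}" for A
  proof -
    have "(\<Sum>x\<in>A. \<Sum>y\<in>{..<d} - A. pmf (uniform_dist d) x * U $$ (x, y)) = flow A / d"
      unfolding flow_def sum_divide_distrib
      using that by (intro sum.cong refl) (auto simp: pmf_uniform_dist subset_iff)
    then show ?thesis using assms that by (simp add: prob_uniform_dist)
  qed
  ultimately show ?thesis unfolding cheeger_constant_def by (intro arg_cong[of _ _ Min] image_cong) auto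
qed

lemma cheeger_finite: "finite ((\<lambda>A. flow A / card A) ` {A. A \<subseteq> {..<d} \<and> A \<noteq> {} \<and> 2 * card A \<le> d})"
  by (rule finite_imageI, rule finite_subset[of _ "Pow {..<d}"]) auto

lemma cheeger_le:
  assumes "A \<subseteq> {..<d}" "A \<noteq> {}" "2 * card A \<le> d"
  shows "cheeger_constant d U * card A \<le> flow A"
proof -
  have "0 < card A" using assms finite_subset by (subst card_gt_0_iff) blast
  moreover have "cheeger_constant d U \<le> flow A / card A"
    using assms \<open>0 < card A\<close> by (subst cheeger_eq) (auto intro!: Min_le[OF cheeger_finite])
  ultimately show ?thesis by (simp add: field_simps)
qed

lemma cheeger_attained:
  assumes "d \<ge> 2"
  obtains A where "A \<subseteq> {..<d}" "A \<noteq> {}" "2 * card A \<le> d" "cheeger_constant d U = flow A / card A"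
proof -
  have "{0} \<in> {A. A \<subseteq> {..<d} \<and> A \<noteq> {} \<and> 2 * card A \<le> d}" using assms by auto
  then have "(\<lambda>A. flow A / card A) ` {A. A \<subseteq> {..<d} \<and> A \<noteq> {} \<and> 2 * card A \<le> d} \<noteq> {}" by blast
  from Min_in[OF cheeger_finite this] show thesis
    using that cheeger_eq assms by auto
qed

text \<open>Averaging: the flow out of \<open>A\<close> is at least the Cheeger constant and is a
  sum of at most d^2 entries.\<close>

lemma cut_edge:
  assumes pos: "0 < cheeger_constant d U" and A: "A \<subseteq> {..<d}" "A \<noteq> {}" "A \<noteq> {..<d}"
  shows "\<exists>x\<in>A. \<exists>y\<in>{..<d} - A. cheeger_constant d U / d\<^sup>2 \<le> U $$ (x, y)"
proof (rule ccontr)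
  assume small: "\<not> ?thesis"
  define C where "C = {..<d} - A"
  define \<Phi> where "\<Phi> = cheeger_constant d U"
  have fin: "finite A" "finite C" using A finite_subset by (auto simp: C_def)
  have C: "C \<subseteq> {..<d}" "C \<noteq> {}" using A by (auto simp: C_def)
  have card: "1 \<le> card A" "1 \<le> card C" "card A + card C = d"
    using fin A C card_Diff_subset[of A "{..<d}"] card_mono[of "{..<d}" A]
    by (auto simp: C_def Suc_le_eq card_gt_0_iff)
  \<comment> \<open>If \<open>A\<close> is more than half of the space, its complement is admissible
    and has the same flow. The cardinality in \<open>cheeger_le\<close> is at least 1.\<close>
  have "\<Phi> \<le> flow A"
  proof (cases "2 * card A \<le> d")
    case True
    have "\<Phi> * 1 \<le> \<Phi> * card A" using pos card by (intro mult_left_mono) (auto simp: \<Phi>_def)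
    then show ?thesis using cheeger_le[OF A(1,2) True] by (simp add: \<Phi>_def)
  next
    case False
    then have "2 * card C \<le> d" using card by simp
    moreover have "\<Phi> * 1 \<le> \<Phi> * card C" using pos card by (intro mult_left_mono) (auto simp: \<Phi>_def)
    ultimately show ?thesis using cheeger_le[OF C] flow_compl[OF A(1)] by (simp add: \<Phi>_def C_def)
  qed
  also have "flow A < (\<Sum>x\<in>A. \<Sum>y\<in>C. \<Phi> / d\<^sup>2)"
    unfolding flow_def C_def[symmetric] using small fin A C
    by (intro sum_strict_mono) (auto simp: C_def \<Phi>_def not_le)
  also have "\<dots> = (real (card A) * real (card C) / (real d * real d)) * \<Phi>"
    by (simp add: power2_eq_square)
  also have "\<dots> \<le> 1 * \<Phi>"
  proof (intro mult_right_mono)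
    have "real (card A) * real (card C) \<le> real d * real d"
      using card by (intro mult_mono) auto
    then show "real (card A) * real (card C) / (real d * real d) \<le> 1"
      using card by (simp add: divide_le_eq)
  qed (use pos in \<open>simp add: \<Phi>_def\<close>)
  finally show False by simp
qed

text \<open>This is 2 * d times the Dirichlet form of the chain.\<close>

definition energy :: "(nat \<Rightarrow> complex) \<Rightarrow> real" where
  "energy w = (\<Sum>x<d. \<Sum>y<d. U $$ (x, y) * (cmod (w x - w y))\<^sup>2)"

text \<open>The sets of points within distance \<open>k r\<close> of \<open>w a\<close> grow with \<open>k\<close> until they exhaust the
  state space, since some heavy edge leaves each proper one.\<close>

lemma diff_le_energy:
  assumes pos: "0 < cheeger_constant d U" and ab: "a < d" "b < d"
  shows "(cmod (w a - w b))\<^sup>2 \<le> real d ^ 4 / cheeger_constant d U * energy w"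
proof -
  define \<Phi> where "\<Phi> = cheeger_constant d U"
  \<comment> \<open>Chosen so that an edge of weight at least \<Phi> / d^2 changes \<open>w\<close>
    by at most \<open>r\<close>: its term alone is at most the whole energy.\<close>
  define r where "r = sqrt (energy w * d\<^sup>2 / \<Phi>)"
  have d: "0 < d" using ab by simp
  have energy: "0 \<le> energy w"
    unfolding energy_def using nonneg by (intro sum_nonneg mult_nonneg_nonneg) auto
  have r: "0 \<le> r" "r\<^sup>2 = energy w * d\<^sup>2 / \<Phi>"
    using energy pos by (auto simp: r_def \<Phi>_def)
  have edge: "cmod (w x - w y) \<le> r" if "x < d" "y < d" "\<Phi> / d\<^sup>2 \<le> U $$ (x, y)" for x y
  proof -
    have "\<Phi> / d\<^sup>2 * (cmod (w x - w y))\<^sup>2 \<le> U $$ (x, y) * (cmod (w x - w y))\<^sup>2"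
      using that by (intro mult_right_mono) auto
    also have "\<dots> \<le> (\<Sum>y<d. U $$ (x, y) * (cmod (w x - w y))\<^sup>2)"
      using that nonneg by (intro member_le_sum) auto
    also have "\<dots> \<le> energy w"
      unfolding energy_def using that nonneg
      by (intro member_le_sum[of x "{..<d}" "\<lambda>x. \<Sum>y<d. U $$ (x, y) * (cmod (w x - w y))\<^sup>2"] sum_nonneg) auto
    finally have "(cmod (w x - w y))\<^sup>2 \<le> r\<^sup>2"
      using pos d unfolding r by (simp add: \<Phi>_def field_simps)
    then show ?thesis using r by (rule_tac power2_le_imp_le)
  qed
  define S where "S k = {x. x < d \<and> cmod (w x - w a) \<le> real k * r}" for k
  have fin: "finite (S k)" for k by (simp add: S_def)
  have card: "min d (Suc k) \<le> card (S k)" for k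
  proof (induction k)
    case 0
    have "{a} \<subseteq> S 0" using ab by (auto simp: S_def)
    from card_mono[OF fin this] show ?case by simp
  next
    case (Suc k)
    have sub: "S k \<subseteq> S (Suc k)" using r by (auto simp: S_def algebra_simps)
    show ?case
    proof (cases "S k = {..<d}")
      case True
      then have "S (Suc k) = {..<d}" using sub by (auto simp: S_def)
      then show ?thesis by simp
    next
      case False
      have "a \<in> S k" using ab r by (auto simp: S_def)
      then obtain x y where xy: "x \<in> S k" "y < d" "y \<notin> S k" "\<Phi> / d\<^sup>2 \<le> U $$ (x, y)"
      proof -
        have "S k \<subseteq> {..<d}" "S k \<noteq> {}" using \<open>a \<in> S k\<close> by (auto simp: S_def)
        from cut_edge[OF pos this False] show ?thesis using that unfolding \<Phi>_def by blast
      qed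
      have "cmod (w y - w a) \<le> cmod (w x - w y) + cmod (w x - w a)"
        using norm_triangle_ineq[of "w y - w x" "w x - w a"] by (simp add: norm_minus_commute)
      also have "\<dots> \<le> r + real k * r"
        using xy by (intro add_mono edge) (auto simp: S_def)
      finally have "y \<in> S (Suc k)" using xy by (simp add: S_def algebra_simps)
      then have "S k \<subset> S (Suc k)" using sub xy by blast
      from psubset_card_mono[OF fin this] show ?thesis using Suc by linarith
    qed
  qed
  \<comment> \<open>By the cardinality bound, \<open>d\<close> steps of length \<open>r\<close>
    reach every state.\<close>
  have "S d \<subseteq> {..<d}" by (auto simp: S_def)
  moreover have "card {..<d} \<le> card (S d)" using card[of d] by simp
  ultimately have "S d = {..<d}" by (intro card_seteq) auto
  then have "b \<in> S d" using ab by simp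
  then have "cmod (w a - w b) \<le> real d * r"
    by (simp add: S_def norm_minus_commute)
  then have "(cmod (w a - w b))\<^sup>2 \<le> (real d * r)\<^sup>2" by (intro power_mono) auto
  also have "\<dots> = real d ^ 4 / \<Phi> * energy w"
    by (simp only: power_mult_distrib r) (simp add: power4_eq_xxxx power2_eq_square)
  finally show ?thesis by (simp add: \<Phi>_def)
qed

lemma cmod_diff_sq: "(cmod (x - y))\<^sup>2 = (cmod x)\<^sup>2 + (cmod y)\<^sup>2 - 2 * Re (cnj x * y)"
  by (simp only: cmod_power2) (simp add: power2_eq_square algebra_simps)

text \<open>Expanding the square gives the squared norm twice, once from the row sums and once from
  the column sums. The cross term is the real part of the inner product of \<open>w\<close> with
  \<open>L w\<close>.\<close>

lemma energy_eigen:
  assumes "\<And>i. i < d \<Longrightarrow> L w i = l * w i"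
  shows "energy w = 2 * (1 - Re l) * (\<Sum>i<d. (cmod (w i))\<^sup>2)"
proof -
  define N where "N = (\<Sum>i<d. (cmod (w i))\<^sup>2)"
  have "energy w = (\<Sum>x<d. \<Sum>y<d. U $$ (x, y) * (cmod (w x))\<^sup>2)
      + (\<Sum>x<d. \<Sum>y<d. U $$ (x, y) * (cmod (w y))\<^sup>2)
      - 2 * (\<Sum>x<d. \<Sum>y<d. U $$ (x, y) * Re (cnj (w x) * w y))"
    unfolding energy_def cmod_diff_sq sum_distrib_left sum.distrib[symmetric] sum_subtractf[symmetric]
    by (intro sum.cong refl) (simp add: algebra_simps)
  also have "(\<Sum>x<d. \<Sum>y<d. U $$ (x, y) * (cmod (w x))\<^sup>2) = N"
    by (simp add: N_def row_sum flip: sum_distrib_right)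
  also have "(\<Sum>x<d. \<Sum>y<d. U $$ (x, y) * (cmod (w y))\<^sup>2) = N"
    by (subst sum.swap) (simp add: N_def col_sum flip: sum_distrib_right)
  also have "(\<Sum>x<d. \<Sum>y<d. U $$ (x, y) * Re (cnj (w x) * w y)) = Re (\<Sum>x<d. cnj (w x) * L w x)"
    unfolding L_def by (simp add: sum_distrib_left algebra_simps)
  also have "(\<Sum>x<d. cnj (w x) * L w x) = (\<Sum>x<d. l * of_real ((cmod (w x))\<^sup>2))"
    using assms by (intro sum.cong refl) (simp only: complex_norm_square lessThan_iff mult_ac)
  also have "Re \<dots> = Re l * N"
    by (simp add: N_def sum_distrib_left del: of_real_power)
  finally show ?thesis by (simp add: N_def algebra_simps)
qed

text \<open>The energy of a non-constant eigenfunction is positive, so Re l < 1 and, as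
  \<open>L\<close> preserves sums, \<open>w\<close> has sum zero. Comparing all pairwise differences
  with the energy then bounds the gap from below.\<close>

lemma gap_ge_cheeger:
  assumes "d \<ge> 2" and pos: "0 < cheeger_constant d U"
  shows "cheeger_constant d U / real d ^ 5 \<le> gap"
    and "nonconst_eigen l w \<Longrightarrow> (\<Sum>i<d. w i) = 0"
proof -
  define \<Phi> where "\<Phi> = cheeger_constant d U"
  have sum0: "Re l < 1 \<and> (\<Sum>i<d. w i) = 0" if "nonconst_eigen l w" for l w
  proof -
    from that obtain a b where ab: "a < d" "b < d" "w a \<noteq> w b"
      and eig: "\<And>i. i < d \<Longrightarrow> L w i = l * w i" by (auto simp: nonconst_eigen_def)
    have "0 < (cmod (w a - w b))\<^sup>2" using ab by simp
    also note diff_le_energy[OF pos ab(1,2)]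
    finally have "0 < energy w" using pos assms by (simp add: zero_less_mult_iff zero_less_divide_iff)
    moreover have "energy w \<le> 0" if "1 \<le> Re l"
    proof -
      have "energy w = 2 * (1 - Re l) * (\<Sum>i<d. (cmod (w i))\<^sup>2)"
        using eig by (rule energy_eigen)
      also have "\<dots> \<le> 0" using that by (intro mult_nonpos_nonneg[of "2 * (1 - Re l)"] sum_nonneg) auto
      finally show ?thesis .
    qed
    ultimately have lt: "Re l < 1" by fastforce
    have "(\<Sum>i<d. w i) = l * (\<Sum>i<d. w i)"
      using L_sum[of w] eig by (simp add: sum_distrib_left)
    then show ?thesis using lt by auto
  qed
  then show "nonconst_eigen l w \<Longrightarrow> (\<Sum>i<d. w i) = 0" by blast
  obtain l w where w: "nonconst_eigen l w" and gap: "gap = 1 - Re l"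
    using gap_attained[OF assms(1)] by blast
  define N where "N = (\<Sum>i<d. (cmod (w i))\<^sup>2)"
  have z: "(\<Sum>i<d. w i) = 0" using sum0[OF w] by blast
  have "0 < N"
  proof -
    from w obtain a b where "a < d" "b < d" "w a \<noteq> w b" by (auto simp: nonconst_eigen_def)
    then obtain i where "i < d" "w i \<noteq> 0" by (cases "w a = 0") auto
    then show ?thesis unfolding N_def by (intro sum_pos2[of _ i]) auto
  qed
  \<comment> \<open>The cross terms vanish because \<open>w\<close> has sum zero.\<close>
  have "2 * d * N = (\<Sum>a<d. \<Sum>b<d. (cmod (w a - w b))\<^sup>2)"
  proof -
    have "(\<Sum>a<d. \<Sum>b<d. (cmod (w a - w b))\<^sup>2)
      = (\<Sum>a<d. \<Sum>b<d. (cmod (w a))\<^sup>2) + (\<Sum>a<d. \<Sum>b<d. (cmod (w b))\<^sup>2)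
        - 2 * (\<Sum>a<d. \<Sum>b<d. Re (cnj (w a) * w b))"
      unfolding cmod_diff_sq sum_distrib_left sum.distrib[symmetric] sum_subtractf[symmetric] ..
    also have "(\<Sum>a<d. \<Sum>b<d. Re (cnj (w a) * w b)) = Re (\<Sum>a<d. cnj (w a) * (\<Sum>b<d. w b))"
      by (simp only: sum_distrib_left Re_sum)
    also have "\<dots> = 0" by (simp add: z)
    finally show ?thesis by (simp add: N_def sum_distrib_left mult.assoc)
  qed
  also have "\<dots> \<le> (\<Sum>a<d. \<Sum>b<d. real d ^ 4 / \<Phi> * energy w)"
    unfolding \<Phi>_def by (intro sum_mono diff_le_energy[OF pos]) auto
  \<comment> \<open>There are d^2 pairs with a bound of order d^4 each; one factor d is matched by
    the left side, which leaves d^5.\<close>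
  also have "\<dots> = 2 * d * N * (real d ^ 5 / \<Phi> * gap)"
    using w by (simp add: energy_eigen[of w l] nonconst_eigen_def gap N_def eval_nat_numeral)
  finally have "2 * d * N * 1 \<le> 2 * d * N * (real d ^ 5 / \<Phi> * gap)" by simp
  moreover have "0 < 2 * d * N" using \<open>0 < N\<close> assms(1) by simp
  ultimately have "1 \<le> real d ^ 5 / \<Phi> * gap" by (simp only: mult_le_cancel_left_pos)
  then show "cheeger_constant d U / real d ^ 5 \<le> gap"
    using pos assms(1) by (simp add: \<Phi>_def field_simps)
qed

text \<open>A minimising set of zero flow could not be left in any number of steps, which
  contradicts irreducibility.\<close>

lemma irreducible_cheeger_pos:
  assumes "d \<ge> 2" "irreducible_matrix d U"
  shows "0 < cheeger_constant d U"
proof -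
  obtain A where A: "A \<subseteq> {..<d}" "A \<noteq> {}" "2 * card A \<le> d" "cheeger_constant d U = flow A / card A"
    using cheeger_attained[OF assms(1)] .
  have fin: "finite A" using A finite_subset by blast
  have "flow A \<noteq> 0"
  proof
    assume "flow A = 0"
    have zero: "U $$ (x, y) = 0" if "x \<in> A" "y < d" "y \<notin> A" for x y
    proof -
      have x: "x' < d" if "x' \<in> A" for x' using that A by auto
      have "(\<Sum>y\<in>{..<d} - A. U $$ (x, y)) = 0"
        using fin _ \<open>flow A = 0\<close>[unfolded flow_def] \<open>x \<in> A\<close>
        by (rule sum_nonneg_0) (intro sum_nonneg nonneg, auto simp: x)
      then show ?thesis
        using that nonneg x by (intro sum_nonneg_0[of "{..<d} - A" "\<lambda>y. U $$ (x, y)" y]) auto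
    qed
    have pow: "(U ^\<^sub>m k) $$ (x, y) = 0" if "x \<in> A" "y < d" "y \<notin> A" for k x y
      using that(2,3)
    proof (induction k arbitrary: y)
      case 0
      have "x < d" "x \<noteq> y" using that(1) A 0 by auto
      then show ?case using 0 by simp
    next
      case (Suc k)
      have "(U ^\<^sub>m Suc k) $$ (x, y) = (\<Sum>l<d. (U ^\<^sub>m k) $$ (x, l) * U $$ (l, y))"
        using Suc.prems that(1) A
        by (simp only: pow_mat.simps) (intro index_mult_sum pow_carrier_mat carrier, auto)
      also have "\<dots> = 0"
        using Suc zero by (intro sum.neutral) (metis lessThan_iff mult_eq_0_iff)
      finally show ?case .
    qed
    have "A \<noteq> {..<d}" using A assms by auto
    then obtain x y where "x \<in> A" "y < d" "y \<notin> A" using A by blast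
    moreover have "x < d" using \<open>x \<in> A\<close> A by auto
    ultimately show False using assms(2) pow unfolding irreducible_matrix_def by (metis less_irrefl)
  qed
  then have "0 < flow A" using flow_nonneg[OF A(1)] by simp
  moreover have "0 < card A" using fin A by (simp add: card_gt_0_iff)
  ultimately show ?thesis by (simp add: A(4))
qed

end

text \<open>A value \<open>r > 1\<close> would be squared at each doubling of time, so
  \<open>G\<close> at 2^m t would be at least \<open>r ^ (2 ^ m)\<close>, more than a polynomial
  bound permits.\<close>

lemma le_one_if_square_le_double:
  fixes G :: "real \<Rightarrow> real"
  assumes nonneg: "\<And>t. 0 \<le> t \<Longrightarrow> 0 \<le> G t"
    and double: "\<And>t. 0 \<le> t \<Longrightarrow> (G t)\<^sup>2 \<le> G (2 * t)"
    and growth: "\<And>t. 0 \<le> t \<Longrightarrow> G t \<le> C * (1 + t) ^ k"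
    and "0 \<le> t"
  shows "G t \<le> 1"
proof (rule ccontr)
  assume "\<not> G t \<le> 1"
  define r where "r = G t"
  have r: "1 < r" using \<open>\<not> G t \<le> 1\<close> by (simp add: r_def)
  have iter: "r ^ (2 ^ m) \<le> G (2 ^ m * t)" for m
  proof (induction m)
    case (Suc m)
    have "r ^ (2 ^ Suc m) = (r ^ (2 ^ m))\<^sup>2" by (simp add: power_mult[symmetric] mult.commute)
    also have "\<dots> \<le> (G (2 ^ m * t))\<^sup>2" using Suc r by (intro power_mono) auto
    also have "\<dots> \<le> G (2 * (2 ^ m * t))" using \<open>0 \<le> t\<close> by (intro double) auto
    finally show ?case by (simp add: mult.assoc)
  qed (simp add: r_def)
  have "(\<lambda>n::nat. C * (1 + real n * t) ^ k / r ^ n) \<longlonglongrightarrow> 0"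
  proof -
    have "(\<lambda>n::nat. \<bar>C\<bar> * (1 + t) ^ k * (real n ^ k / r ^ n)) \<longlonglongrightarrow> \<bar>C\<bar> * (1 + t) ^ k * 0"
    proof (intro tendsto_mult_left)
      show "(\<lambda>n::nat. real n ^ k / r ^ n) \<longlonglongrightarrow> 0" using r by real_asymp
    qed
    then have lim: "(\<lambda>n::nat. \<bar>C\<bar> * (1 + t) ^ k * (real n ^ k / r ^ n)) \<longlonglongrightarrow> 0" by simp
    show ?thesis
    proof (rule Lim_null_comparison[OF _ lim], intro eventually_sequentiallyI[of 1])
      fix n :: nat assume "1 \<le> n"
      then have "1 + real n * t \<le> (1 + t) * real n" using \<open>0 \<le> t\<close> by (simp add: algebra_simps)
      then have "(1 + real n * t) ^ k \<le> ((1 + t) * real n) ^ k" using \<open>0 \<le> t\<close> by (intro power_mono) auto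
      then have "\<bar>C\<bar> * (1 + real n * t) ^ k / r ^ n \<le> \<bar>C\<bar> * ((1 + t) ^ k * real n ^ k) / r ^ n"
        unfolding power_mult_distrib using r by (intro divide_right_mono mult_left_mono) auto
      then show "norm (C * (1 + real n * t) ^ k / r ^ n) \<le> \<bar>C\<bar> * (1 + t) ^ k * (real n ^ k / r ^ n)"
        using r \<open>0 \<le> t\<close> by (simp add: abs_mult power_abs)
    qed
  qed
  then have "\<forall>\<^sub>F n in sequentially. C * (1 + real n * t) ^ k / r ^ n < 1"
    by (rule order_tendstoD) simp
  then obtain n0 where n0: "\<And>n. n \<ge> n0 \<Longrightarrow> C * (1 + real n * t) ^ k / r ^ n < 1"
    by (auto simp: eventually_sequentially)
  \<comment> \<open>The limit runs over all \<open>n\<close>, whereas the iterated estimate holds at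
    powers of two; 2 ^ n0 is one beyond \<open>n0\<close>.\<close>
  have "n0 \<le> 2 ^ n0" using less_exp[of n0] by simp
  from n0[OF this] have "C * (1 + 2 ^ n0 * t) ^ k < r ^ (2 ^ n0)"
    using r by (simp add: divide_less_eq)
  also have "\<dots> \<le> G (2 ^ n0 * t)" by (rule iter)
  also have "\<dots> \<le> C * (1 + 2 ^ n0 * t) ^ k" using \<open>0 \<le> t\<close> by (intro growth) auto
  finally show False by simp
qed

context doubly_stochastic
begin

subsection \<open>Symmetric kernels\<close>

text \<open>\<open>X\<close> on real vectors, so that squares and inner products stay real.\<close>

definition Y :: "real \<Rightarrow> (nat \<Rightarrow> real) \<Rightarrow> nat \<Rightarrow> real" where
  "Y t v i = (\<Sum>j<d. P t i j * v j)"

lemma X_of_real: "X t (\<lambda>j. complex_of_real (v j)) i = of_real (Y t v i)"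
  by (simp add: X_def Y_def)

lemma Y_deriv:
  assumes "i < d"
  shows "((\<lambda>t. Y t v i) has_real_derivative (\<Sum>l<d. B $$ (i, l) * Y t v l)) (at t)"
proof -
  have "((\<lambda>t. Y t v i) has_real_derivative (\<Sum>j<d. (\<Sum>l<d. B $$ (i, l) * P t l j) * v j)) (at t)"
    unfolding Y_def using assms by (intro DERIV_sum DERIV_cmult_right P_deriv_left) auto
  also have "(\<Sum>j<d. (\<Sum>l<d. B $$ (i, l) * P t l j) * v j) = (\<Sum>l<d. B $$ (i, l) * Y t v l)"
    unfolding Y_def sum_distrib_left sum_distrib_right by (subst sum.swap) (simp add: mult.assoc)
  finally show ?thesis .
qed

lemma Y_0: "i < d \<Longrightarrow> Y 0 v i = v i"
  by (simp add: Y_def P_0 if_distrib if_distribR cong: if_cong)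

text \<open>The pairing \<open>g s\<close> of the flows at times t - s and t + s is constant in
  \<open>s\<close>, because a symmetric \<open>B\<close> can be moved from one side to the other.
  Its values at 0 and \<open>t\<close> are the two sides of the claim, so the semigroup law is
  bypassed.\<close>

lemma Y_norm_symmetric:
  assumes sym: "\<And>i j. i < d \<Longrightarrow> j < d \<Longrightarrow> U $$ (i, j) = U $$ (j, i)"
  shows "(\<Sum>i<d. (Y t v i)\<^sup>2) = (\<Sum>i<d. v i * Y (2 * t) v i)"
proof -
  have B_sym: "B $$ (i, j) = B $$ (j, i)" if "i < d" "j < d" for i j
    using that sym by (simp add: B_index)
  define g where "g s = (\<Sum>i<d. Y (t - s) v i * Y (t + s) v i)" for s
  have "(g has_real_derivative 0) (at s)" for s
  proof -
    have d1: "((\<lambda>s. Y (t - s) v i) has_real_derivative - (\<Sum>l<d. B $$ (i, l) * Y (t - s) v l)) (at s)"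
      if "i < d" for i
    proof -
      have "((\<lambda>s. t - s) has_real_derivative -1) (at s)" by (auto intro!: derivative_eq_intros)
      from DERIV_chain2[where f = "\<lambda>t. Y t v i", OF Y_deriv[OF that] this] show ?thesis by simp
    qed
    have d2: "((\<lambda>s. Y (t + s) v i) has_real_derivative (\<Sum>l<d. B $$ (i, l) * Y (t + s) v l)) (at s)"
      if "i < d" for i
    proof -
      have "((\<lambda>s. t + s) has_real_derivative 1) (at s)" by (auto intro!: derivative_eq_intros)
      from DERIV_chain2[where f = "\<lambda>t. Y t v i", OF Y_deriv[OF that] this] show ?thesis by simp
    qed
    have "(g has_real_derivative (\<Sum>i<d. - (\<Sum>l<d. B $$ (i, l) * Y (t - s) v l) * Y (t + s) v i
        + (\<Sum>l<d. B $$ (i, l) * Y (t + s) v l) * Y (t - s) v i)) (at s)"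
      unfolding g_def by (intro DERIV_sum DERIV_mult d1 d2) auto
    moreover have "(\<Sum>i<d. (\<Sum>l<d. B $$ (i, l) * Y (t - s) v l) * Y (t + s) v i)
        = (\<Sum>i<d. (\<Sum>l<d. B $$ (i, l) * Y (t + s) v l) * Y (t - s) v i)"
      unfolding sum_distrib_right using B_sym
      by (subst sum.swap) (intro sum.cong refl, simp add: mult_ac)
    ultimately show ?thesis by (simp add: sum.distrib sum_negf sum_subtractf)
  qed
  then have "g 0 = g t" by (intro DERIV_isconst_all) auto
  then show ?thesis by (simp add: g_def power2_eq_square Y_0)
qed

lemma Y_decay_symmetric:
  assumes sym: "\<And>i j. i < d \<Longrightarrow> j < d \<Longrightarrow> U $$ (i, j) = U $$ (j, i)"
    and v: "(\<Sum>i<d. v i) = 0" and t: "0 \<le> t"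
  shows "(\<Sum>i<d. (Y t v i)\<^sup>2) \<le> (\<Sum>i<d. (v i)\<^sup>2) * exp (- 2 * gap * t)"
proof -
  define N where "N t = (\<Sum>i<d. (Y t v i)\<^sup>2)" for t
  have N0: "N 0 = (\<Sum>i<d. (v i)\<^sup>2)" by (simp add: N_def Y_0)
  have N_nonneg: "0 \<le> N t" for t unfolding N_def by (intro sum_nonneg) auto
  \<comment> \<open>Cauchy-Schwarz for \<open>v\<close> against \<open>Y (2 * t) v\<close>; symmetry
    of the matrix enters here.\<close>
  have double: "(N t)\<^sup>2 \<le> N 0 * N (2 * t)" for t
    using Cauchy_Schwarz_ineq_sum[of v "Y (2 * t) v" "{..<d}"] Y_norm_symmetric[OF sym, of t v] N0
    by (simp only: N_def)
  show ?thesis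
  proof (cases "N 0 = 0")
    case True
    then have "N t = 0" using double[of t] by simp
    then show ?thesis using True N0 by (simp add: N_def)
  next
    case False
    then have pos: "0 < N 0" using N_nonneg[of 0] by simp
    define M where "M = (\<Sum>i<d. \<bar>v i\<bar>)"
    define C where "C = d * (M * 2 ^ d)\<^sup>2 / N 0"
    \<comment> \<open>Normalised so that the doubling inequality holds with constant 1 and the claim
      becomes \<open>G t \<le> 1\<close>.\<close>
    define G where "G t = N t * exp (2 * gap * t) / N 0" for t
    have "G t \<le> 1"
    proof (rule le_one_if_square_le_double[of G C "2 * d" t])
      fix s :: real assume s: "0 \<le> s"
      show "0 \<le> G s" using N_nonneg pos by (simp add: G_def)
      have "(G s)\<^sup>2 = (N s)\<^sup>2 * exp (2 * gap * (2 * s)) / (N 0)\<^sup>2"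
        by (simp add: G_def power_divide power_mult_distrib flip: exp_double)
      also have "\<dots> \<le> (N 0 * N (2 * s)) * exp (2 * gap * (2 * s)) / (N 0)\<^sup>2"
        using double by (intro divide_right_mono mult_right_mono) auto
      also have "\<dots> = G (2 * s)" using pos by (simp add: G_def power2_eq_square)
      finally show "(G s)\<^sup>2 \<le> G (2 * s)" .
      have "\<bar>Y s v i\<bar> \<le> M * 2 ^ d * (1 + s) ^ d * exp (- gap * s)" if "i < d" for i
      proof -
        have "cmod (complex_of_real (v j)) \<le> M" if "j < d" for j
          using that member_le_sum[of j "{..<d}" "\<lambda>i. \<bar>v i\<bar>"] by (simp add: M_def)
        moreover have "(\<Sum>i<d. complex_of_real (v i)) = 0" using v by (simp flip: of_real_sum)
        ultimately show ?thesis
          using X_decay_gap[of "\<lambda>i. complex_of_real (v i)" M s i] s that by (simp add: X_of_real)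
      qed
      then have "\<bar>Y s v i\<bar>\<^sup>2 \<le> (M * 2 ^ d * (1 + s) ^ d * exp (- gap * s))\<^sup>2" if "i < d" for i
        using that by (intro power_mono) auto
      then have "N s \<le> (\<Sum>i<d. (M * 2 ^ d * (1 + s) ^ d * exp (- gap * s))\<^sup>2)"
        unfolding N_def by (intro sum_mono) simp
      also have "\<dots> = N 0 * C * (1 + s) ^ (2 * d) * exp (- (2 * gap * s))"
        using pos by (simp add: C_def power_mult_distrib power_mult mult.commute[of 2] flip: exp_double)
      finally have "N s * exp (2 * gap * s) \<le> N 0 * C * (1 + s) ^ (2 * d) * exp (- (2 * gap * s)) * exp (2 * gap * s)"
        by (intro mult_right_mono) auto
      then show "G s \<le> C * (1 + s) ^ (2 * d)"
        using pos by (simp add: G_def divide_le_eq mult.assoc exp_minus_inverse mult.commute[of _ "N 0"]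
          flip: exp_add)
    qed fact
    then have "N t * exp (2 * gap * t) \<le> N 0" using pos by (simp add: G_def)
    then have "N t * exp (2 * gap * t) * exp (- 2 * gap * t) \<le> N 0 * exp (- 2 * gap * t)"
      by (intro mult_right_mono) auto
    then show ?thesis by (simp add: N0[symmetric] mult.assoc N_def flip: exp_add)
  qed
qed

subsection \<open>Mixing times\<close>

text \<open>The condition inside the infimum of \<open>t_mix_single\<close>, with both maxima
  unfolded into quantifiers over starting points and events.\<close>

definition mixed :: "real \<Rightarrow> real \<Rightarrow> bool" where
  "mixed \<epsilon> t \<longleftrightarrow> (\<forall>i<d. \<forall>A\<subseteq>{..<d}. \<bar>(\<Sum>j\<in>A. P t i j) - card A / d\<bar> \<le> \<epsilon>)"

lemma t_mix_eq:
  assumes "0 < d"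
  shows "t_mix_single d U \<epsilon> = Inf {t. 0 \<le> t \<and> mixed \<epsilon> t}"
proof -
  have "(\<Sum>x\<in>A. pmf (uniform_dist d) x) = card A / d" if "A \<subseteq> {..<d}" for A
  proof -
    have "(\<Sum>x\<in>A. pmf (uniform_dist d) x) = (\<Sum>x\<in>A. 1 / d)"
      using that by (intro sum.cong refl pmf_uniform_dist) auto
    then show ?thesis by simp
  qed
  then have "tv_dist d (\<lambda>j. single_ball_kernel d U t $$ (i, j)) (pmf (uniform_dist d)) \<le> \<epsilon>
      \<longleftrightarrow> (\<forall>A\<subseteq>{..<d}. \<bar>(\<Sum>j\<in>A. P t i j) - card A / d\<bar> \<le> \<epsilon>)" for t i
    unfolding tv_dist_def P_def by (subst Max_le_iff) auto
  then have "Max ((\<lambda>i. tv_dist d (\<lambda>j. single_ball_kernel d U t $$ (i, j)) (pmf (uniform_dist d)))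
                  ` {..<d}) \<le> \<epsilon> \<longleftrightarrow> mixed \<epsilon> t" for t
    unfolding mixed_def using assms by (subst Max_le_iff) auto
  then show ?thesis unfolding t_mix_single_def by simp
qed

text \<open>The total variation distance tests \<open>X t\<close> on centred indicators.\<close>

definition centred :: "nat set \<Rightarrow> nat \<Rightarrow> real" where
  "centred A j = (if j \<in> A then 1 else 0) - card A / d"

text \<open>Since the rows of \<open>P t\<close> sum to one, the constant subtracted from the
  indicator comes through unchanged.\<close>

lemma Y_centred:
  assumes "A \<subseteq> {..<d}" "i < d"
  shows "Y t (centred A) i = (\<Sum>j\<in>A. P t i j) - card A / d"
proof -
  have "Y t (centred A) i = (\<Sum>j<d. if j \<in> A then P t i j else 0) - (\<Sum>j<d. P t i j) * (card A / d)"
    unfolding Y_def centred_def sum_distrib_right sum_subtractf[symmetric]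
    by (intro sum.cong refl) (simp add: algebra_simps)
  moreover have "(\<Sum>j<d. if j \<in> A then P t i j else 0) = (\<Sum>j\<in>A. P t i j)"
    using assms by (simp add: sum.inter_restrict[symmetric] Int_absorb1)
  ultimately show ?thesis using assms by (simp add: P_row_sum)
qed

lemma centred_sum:
  assumes "A \<subseteq> {..<d}" "0 < d"
  shows "(\<Sum>j<d. centred A j) = 0"
proof -
  have "(\<Sum>j<d. if j \<in> A then 1 else (0::real)) = card A"
    using assms by (simp add: sum.inter_restrict[symmetric] Int_absorb1)
  then show ?thesis using assms by (simp add: centred_def sum_subtractf)
qed

lemma centred_le_1:
  assumes "A \<subseteq> {..<d}" "j < d"
  shows "\<bar>centred A j\<bar> \<le> 1"
proof -
  have "card A \<le> d" using card_mono[of "{..<d}" A] assms by simp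
  then have "0 \<le> card A / real d" "card A / real d \<le> 1" using assms by (auto simp: divide_le_eq)
  then show ?thesis by (auto simp: centred_def)
qed

lemma mixed_general:
  assumes "0 \<le> t" "2 ^ d * (1 + t) ^ d * exp (- gap * t) \<le> \<epsilon>"
  shows "mixed \<epsilon> t"
  unfolding mixed_def
proof (intro allI impI)
  fix i A assume i: "i < d" and A: "A \<subseteq> {..<d}"
  have "(\<Sum>j<d. complex_of_real (centred A j)) = 0"
    using centred_sum[OF A] i by (simp flip: of_real_sum)
  from X_decay_gap[OF this, of 1 t i]
  have "\<bar>Y t (centred A) i\<bar> \<le> 2 ^ d * (1 + t) ^ d * exp (- gap * t)"
    using assms i centred_le_1[OF A] by (simp add: X_of_real)
  then show "\<bar>(\<Sum>j\<in>A. P t i j) - card A / d\<bar> \<le> \<epsilon>"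
    using assms Y_centred[OF A i] by simp
qed

lemma mixed_symmetric:
  assumes sym: "\<And>i j. i < d \<Longrightarrow> j < d \<Longrightarrow> U $$ (i, j) = U $$ (j, i)"
    and "0 \<le> t" "sqrt d * exp (- gap * t) \<le> \<epsilon>"
  shows "mixed \<epsilon> t"
  unfolding mixed_def
proof (intro allI impI)
  fix i A assume i: "i < d" and A: "A \<subseteq> {..<d}"
  have "(Y t (centred A) i)\<^sup>2 \<le> (\<Sum>i<d. (Y t (centred A) i)\<^sup>2)"
    using i by (intro member_le_sum) auto
  also have "\<dots> \<le> (\<Sum>i<d. (centred A i)\<^sup>2) * exp (- 2 * gap * t)"
    using centred_sum[OF A] i assms by (intro Y_decay_symmetric) auto
  \<comment> \<open>All \<open>d\<close> entries are at most 1 in modulus, which is the source of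
    the factor \<open>sqrt d\<close>.\<close>
  also have "\<dots> \<le> (\<Sum>i<d. 1) * exp (- 2 * gap * t)"
    using centred_le_1[OF A] by (intro mult_right_mono sum_mono) (auto simp: abs_le_square_iff[of _ 1, simplified])
  also have "\<dots> = (sqrt d * exp (- gap * t))\<^sup>2"
    by (simp add: power_mult_distrib flip: exp_double)
  finally have "\<bar>Y t (centred A) i\<bar> \<le> sqrt d * exp (- gap * t)"
    by (simp add: abs_le_square_iff[symmetric])
  then show "\<bar>(\<Sum>j\<in>A. P t i j) - card A / d\<bar> \<le> \<epsilon>"
    using assms Y_centred[OF A i] by simp
qed

text \<open>Take an eigenfunction that realises the gap and start the chain where its modulus is
  maximal. Its decay factor is a lower bound for the l1 distance between that row and the uniform
  distribution, which is at most twice \<epsilon>.\<close>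

lemma mixed_lower:
  assumes "d \<ge> 2" "0 < cheeger_constant d U" "mixed \<epsilon> t"
  shows "exp (- gap * t) \<le> 2 * \<epsilon>"
proof -
  obtain l w where w: "nonconst_eigen l w" and gap: "gap = 1 - Re l"
    using gap_attained[OF assms(1)] by blast
  have z: "(\<Sum>i<d. w i) = 0" using gap_ge_cheeger(2)[OF assms(1,2) w] .
  define M where "M = Max ((\<lambda>i. cmod (w i)) ` {..<d})"
  have le: "cmod (w i) \<le> M" if "i < d" for i unfolding M_def using that by (intro Max_ge) auto
  have "M \<in> (\<lambda>i. cmod (w i)) ` {..<d}" unfolding M_def using assms(1) by (intro Max_in) (auto simp: lessThan_empty_iff)
  then obtain i where i: "i < d" "cmod (w i) = M" by auto
  from w obtain a b where "a < d" "b < d" "w a \<noteq> w b" by (auto simp: nonconst_eigen_def)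
  then obtain c where "c < d" "w c \<noteq> 0" by (cases "w a = 0") auto
  then have "0 < M" using le[of c] by (metis zero_less_norm_iff order_less_le_trans)
  \<comment> \<open>The states of nonnegative deviation. The l1 distance is split over this event
    and its complement, and each contributes at most \<epsilon>.\<close>
  define A where "A = {j. j < d \<and> 1 / d \<le> P t i j}"
  have A: "A \<subseteq> {..<d}" by (auto simp: A_def)
  have "exp (- gap * t) * M = cmod (X t w i)"
    using w i(1) by (subst X_eigenvector[of w l])
      (auto simp: nonconst_eigen_def norm_mult norm_exp_eq_Re gap i(2))
  \<comment> \<open>Subtracting the uniform distribution changes nothing because \<open>w\<close>
    has sum zero.\<close>
  also have "X t w i = (\<Sum>j<d. of_real (P t i j - 1 / d) * w j)"
    using z by (simp add: X_def left_diff_distrib sum_subtractf sum_distrib_left[symmetric]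
      flip: of_real_divide sum_divide_distrib)
  also have "cmod \<dots> \<le> (\<Sum>j<d. \<bar>P t i j - 1 / d\<bar> * M)"
    by (intro sum_norm_le) (auto simp: norm_mult simp del: of_real_diff intro!: mult_left_mono le)
  also have "\<dots> = (\<Sum>j<d. \<bar>P t i j - 1 / d\<bar>) * M" by (simp add: sum_distrib_right)
  finally have "exp (- gap * t) \<le> (\<Sum>j<d. \<bar>P t i j - 1 / d\<bar>)" using \<open>0 < M\<close> by simp
  also have "\<dots> = (\<Sum>j\<in>A. \<bar>P t i j - 1 / d\<bar>) + (\<Sum>j\<in>{..<d} - A. \<bar>P t i j - 1 / d\<bar>)"
    using sum.subset_diff[OF A, of "\<lambda>j. \<bar>P t i j - 1 / d\<bar>"] by simp
  also have "(\<Sum>j\<in>A. \<bar>P t i j - 1 / d\<bar>) = (\<Sum>j\<in>A. P t i j - 1 / d)"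
    by (intro sum.cong) (auto simp: A_def)
  also have "\<dots> = (\<Sum>j\<in>A. P t i j) - card A / d" by (simp add: sum_subtractf)
  also have "(\<Sum>j\<in>{..<d} - A. \<bar>P t i j - 1 / d\<bar>) = (\<Sum>j\<in>{..<d} - A. - (P t i j - 1 / d))"
    by (intro sum.cong) (auto simp: A_def)
  also have "\<dots> = - ((\<Sum>j\<in>{..<d} - A. P t i j) - card ({..<d} - A) / d)"
    by (simp add: sum_subtractf sum_negf)
  finally have sums: "exp (- gap * t) \<le> ((\<Sum>j\<in>A. P t i j) - card A / d)
      + - ((\<Sum>j\<in>{..<d} - A. P t i j) - card ({..<d} - A) / d)" .
  have "\<bar>(\<Sum>j\<in>A. P t i j) - card A / d\<bar> \<le> \<epsilon>" if "A \<subseteq> {..<d}" for A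
    using assms(3) i(1) that by (simp add: mixed_def)
  from this[OF A] this[OF Diff_subset, of A] show ?thesis using sums by linarith
qed


section \<open>Bounds on the mixing time\<close>

lemma t_mix_le:
  assumes "0 < d" "0 \<le> t" "mixed \<epsilon> t"
  shows "t_mix_single d U \<epsilon> \<le> t"
  unfolding t_mix_eq[OF assms(1)] using assms by (intro cInf_lower bdd_belowI[of _ 0]) auto

lemma t_mix_ge:
  assumes "d \<ge> 2" "0 < cheeger_constant d U" "0 < gap" "0 < \<epsilon>"
  shows "- ln (2 * \<epsilon>) / gap \<le> t_mix_single d U \<epsilon>"
proof -
  \<comment> \<open>This yields a mixed time, so that the infimum is taken over a nonempty set and
    can be bounded from below.\<close>
  have "((\<lambda>t::real. 2 ^ d * (1 + t) ^ d * exp (- gap * t)) \<longlongrightarrow> 0) at_top"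
    using \<open>0 < gap\<close> by real_asymp
  then have "\<forall>\<^sub>F t in at_top. 2 ^ d * (1 + t) ^ d * exp (- gap * t) < \<epsilon>"
    using \<open>0 < \<epsilon>\<close> by (rule order_tendstoD)
  then have "\<forall>\<^sub>F t in at_top. 2 ^ d * (1 + t) ^ d * exp (- gap * t) < \<epsilon> \<and> 0 \<le> t"
    using eventually_ge_at_top by (rule eventually_conj)
  then obtain t where "2 ^ d * (1 + t) ^ d * exp (- gap * t) < \<epsilon>" "0 \<le> t"
    using eventually_happens' trivial_limit_at_top_linorder by blast
  then have "t \<in> {t. 0 \<le> t \<and> mixed \<epsilon> t}" using mixed_general[of t \<epsilon>] by simp
  moreover have "- ln (2 * \<epsilon>) / gap \<le> t" if "mixed \<epsilon> t" for t
  proof -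
    have "- gap * t \<le> ln (2 * \<epsilon>)"
      using mixed_lower[OF assms(1,2) that] \<open>0 < \<epsilon>\<close> by (subst ln_ge_iff) auto
    then show ?thesis using \<open>0 < gap\<close> by (simp add: field_simps)
  qed
  ultimately show ?thesis
    unfolding t_mix_eq[OF order_less_le_trans[OF zero_less_numeral assms(1)]]
    by (intro cInf_greatest) auto
qed

lemma t_mix_lower:
  assumes "d \<ge> 2" "0 < cheeger_constant d U" "0 < gap" "1 \<le> n"
  shows "ln (real n) / (2 * gap) - ln 2 / gap \<le> t_mix_single d U (1 / sqrt (real n))"
proof -
  have "ln (real n) / (2 * gap) - ln 2 / gap = - ln (2 * (1 / sqrt (real n))) / gap"
    using assms by (simp add: ln_div ln_sqrt field_simps)
  also have "\<dots> \<le> t_mix_single d U (1 / sqrt (real n))"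
    using assms by (intro t_mix_ge) auto
  finally show ?thesis .
qed

lemma exp_half_ln: "1 \<le> n \<Longrightarrow> exp (- (ln (real n) / 2)) = 1 / sqrt (real n)"
  by (simp add: exp_minus inverse_eq_divide ln_sqrt[symmetric])

lemma t_mix_upper_symmetric:
  assumes sym: "\<And>i j. i < d \<Longrightarrow> j < d \<Longrightarrow> U $$ (i, j) = U $$ (j, i)"
    and "1 \<le> d" "0 < gap" "1 \<le> n"
  shows "t_mix_single d U (1 / sqrt (real n)) \<le> ln (real n) / (2 * gap) + ln d / gap"
proof (intro t_mix_le mixed_symmetric sym)
  \<comment> \<open>The additional \<open>ln d / gap\<close> gives a factor 1 / d, enough against
    \<open>sqrt d\<close>.\<close>
  define t where "t = ln (real n) / (2 * gap) + ln d / gap"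
  have "- gap * t = - (ln (real n) / 2) + - ln (real d)"
    using assms(3) by (simp add: t_def field_simps)
  then have "exp (- gap * t) = 1 / sqrt (real n) * (1 / d)"
    using assms by (simp only: exp_add exp_half_ln) (simp add: exp_minus inverse_eq_divide)
  moreover have "sqrt d \<le> d"
    using assms(2) by (intro real_le_lsqrt) (auto simp: power2_eq_square)
  then have "sqrt d * exp (- gap * t) \<le> d * exp (- gap * t)" by (intro mult_right_mono) auto
  ultimately show "sqrt d * exp (- gap * t) \<le> 1 / sqrt (real n)"
    using assms(2) by simp
qed (use assms in auto)

text \<open>The additional time \<open>K ln (ln n)\<close> gains a factor \<open>(ln n) ^ (- d - 1)\<close>, which absorbs the
  polynomial prefactor.\<close>

lemma t_mix_upper_general:
  assumes "1 \<le> d" "0 < \<kappa>" "\<kappa> \<le> gap" "1 \<le> n" "1 \<le> ln (real n)"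
    and K: "K = (d + 1) / \<kappa>"
    and large: "(2 * (1 + 1 / (2 * \<kappa>) + K)) ^ d \<le> ln (real n)"
  shows "t_mix_single d U (1 / sqrt (real n)) \<le> ln (real n) / (2 * gap) + K * ln (ln (real n))"
proof (intro t_mix_le mixed_general)
  define l where "l = ln (real n)"
  define t where "t = l / (2 * gap) + K * ln l"
  \<comment> \<open>With this constant 1 + t is at most \<open>H\<close> times \<open>l\<close>, and
    \<open>H\<close> depends on the gap only through its lower bound \<kappa>.\<close>
  define H where "H = 1 + 1 / (2 * \<kappa>) + K"
  have l: "1 \<le> l" using assms by (simp add: l_def)
  have gap: "0 < gap" using assms by simp
  have K0: "0 \<le> K" using assms by simp
  have t0: "0 \<le> t" using l gap K0 by (simp add: t_def)
  then show "0 \<le> ln (real n) / (2 * gap) + K * ln (ln (real n))" by (simp add: t_def l_def)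
  have "1 + t \<le> H * l"
  proof -
    have "l / (2 * gap) \<le> l / (2 * \<kappa>)" using assms l by (intro divide_left_mono) auto
    moreover have "K * ln l \<le> K * l" using K0 l ln_bound[of l] by (intro mult_left_mono) auto
    ultimately show ?thesis using l by (simp add: t_def H_def algebra_simps)
  qed
  then have "(1 + t) ^ d \<le> (H * l) ^ d" using t0 by (intro power_mono) auto
  moreover have "exp (- gap * t) \<le> 1 / sqrt (real n) * (1 / l ^ (d + 1))"
  proof -
    \<comment> \<open>\<open>K\<close> is defined with the lower bound \<kappa>, so the product of
      \<open>K\<close> with the gap itself is at least d + 1.\<close>
    have "real (d + 1) * ln l \<le> gap * K * ln l"
    proof (intro mult_right_mono)
      have "real (d + 1) * 1 \<le> real (d + 1) * (gap / \<kappa>)"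
        using assms(2,3) by (intro mult_left_mono) auto
      then show "real (d + 1) \<le> gap * K" by (simp add: K mult.commute)
    qed (use l in simp)
    moreover have "- gap * t = - (ln (real n) / 2) - gap * K * ln l"
      using gap by (simp add: t_def l_def field_simps)
    ultimately have "- gap * t \<le> - (ln (real n) / 2) + - (real (d + 1) * ln l)" by linarith
    then have "exp (- gap * t) \<le> exp (- (ln (real n) / 2)) * exp (- (real (d + 1) * ln l))"
      by (simp flip: exp_add)
    also have "exp (- (real (d + 1) * ln l)) = 1 / l ^ (d + 1)"
      using l by (simp only: exp_minus exp_of_nat_mult) (simp add: inverse_eq_divide)
    finally show ?thesis by (simp only: exp_half_ln[OF assms(4)])
  qed
  ultimately have "2 ^ d * (1 + t) ^ d * exp (- gap * t)
      \<le> 2 ^ d * (H * l) ^ d * (1 / sqrt (real n) * (1 / l ^ (d + 1)))"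
    using t0 l assms(2) K0 by (intro mult_mono mult_nonneg_nonneg) (auto simp: H_def)
  \<comment> \<open>Cancelling l^d leaves one power of \<open>l\<close> in the denominator, which
    dominates the constant (2 * H)^d by \<open>large\<close>.\<close>
  also have "\<dots> = ((2 * H) ^ d / l) * (1 / sqrt (real n))"
    using l by (simp add: power_mult_distrib field_simps)
  also have "\<dots> \<le> 1 * (1 / sqrt (real n))"
    using large l by (intro mult_right_mono) (auto simp: H_def l_def divide_le_eq)
  finally show "2 ^ d * (1 + (ln (real n) / (2 * gap) + K * ln (ln (real n)))) ^ d
      * exp (- gap * (ln (real n) / (2 * gap) + K * ln (ln (real n)))) \<le> 1 / sqrt (real n)"
    by (simp add: t_def l_def)
qed (use assms in auto)

end

section \<open>Single ball matrices of distributions on permutations\<close>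

lemma single_ball_matrix_index:
  assumes "distribution_on_Sym d \<mu>" "i < d" "j < d"
  shows "single_ball_matrix d \<mu> $$ (i, j) = (\<Sum>\<sigma> | \<sigma> permutes {..<d}. if \<sigma> i = j then pmf \<mu> \<sigma> else 0)"
proof -
  let ?S = "{\<sigma>. \<sigma> permutes {..<d}}"
  have fin: "finite ?S" by (simp add: finite_permutations)
  \<comment> \<open>Discarding the null set outside the permutations leads to a finite sum, which
    can be exchanged and reindexed.\<close>
  have "measure_pmf.prob \<mu> {\<sigma>. \<sigma> i = j} = measure_pmf.prob \<mu> ({\<sigma>. \<sigma> i = j} \<inter> ?S)"
    using assms(1) measure_Int_set_pmf[of \<mu> "{\<sigma>. \<sigma> i = j}"] measure_Int_set_pmf[of \<mu> "{\<sigma>. \<sigma> i = j} \<inter> ?S"]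
    unfolding distribution_on_Sym_def by (simp add: Int_assoc Int_absorb1)
  also have "\<dots> = (\<Sum>\<sigma>\<in>{\<sigma>. \<sigma> i = j} \<inter> ?S. pmf \<mu> \<sigma>)"
    using fin by (intro measure_measure_pmf_finite) auto
  also have "\<dots> = (\<Sum>\<sigma>\<in>?S. if \<sigma> i = j then pmf \<mu> \<sigma> else 0)"
    using fin by (subst Int_commute) (simp add: sum.inter_restrict)
  finally show ?thesis using assms by (simp add: single_ball_matrix_def)
qed

text \<open>Every permutation sends \<open>i\<close> to exactly one point and has exactly one
  preimage of \<open>j\<close>, so each row and each column collects the total mass 1.\<close>

lemma doubly_stochastic_single_ball_matrix:
  assumes "distribution_on_Sym d \<mu>"
  shows "doubly_stochastic d (single_ball_matrix d \<mu>)"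
proof
  have total: "(\<Sum>\<sigma> | \<sigma> permutes {..<d}. pmf \<mu> \<sigma>) = 1"
    using assms by (intro sum_pmf_eq_1) (auto simp: distribution_on_Sym_def finite_permutations)
  show "single_ball_matrix d \<mu> \<in> carrier_mat d d" by (simp add: single_ball_matrix_def)
  show "0 \<le> single_ball_matrix d \<mu> $$ (i, j)" if "i < d" "j < d" for i j
    using that by (simp add: single_ball_matrix_def)
  show "(\<Sum>j<d. single_ball_matrix d \<mu> $$ (i, j)) = 1" if "i < d" for i
  proof -
    have "(\<Sum>j<d. single_ball_matrix d \<mu> $$ (i, j))
        = (\<Sum>j<d. \<Sum>\<sigma> | \<sigma> permutes {..<d}. if \<sigma> i = j then pmf \<mu> \<sigma> else 0)"
      using that by (intro sum.cong refl single_ball_matrix_index[OF assms]) auto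
    also have "\<dots> = (\<Sum>\<sigma> | \<sigma> permutes {..<d}. \<Sum>j<d. if \<sigma> i = j then pmf \<mu> \<sigma> else 0)"
      by (rule sum.swap)
    also have "\<dots> = (\<Sum>\<sigma> | \<sigma> permutes {..<d}. pmf \<mu> \<sigma>)"
      using that permutes_in_image[of _ "{..<d}" i] by (intro sum.cong refl) (simp add: sum.delta)
    finally show ?thesis using total by simp
  qed
  show "(\<Sum>i<d. single_ball_matrix d \<mu> $$ (i, j)) = 1" if "j < d" for j
  proof -
    have "(\<Sum>i<d. single_ball_matrix d \<mu> $$ (i, j))
        = (\<Sum>i<d. \<Sum>\<sigma> | \<sigma> permutes {..<d}. if \<sigma> i = j then pmf \<mu> \<sigma> else 0)"
      using that by (intro sum.cong refl single_ball_matrix_index[OF assms]) auto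
    also have "\<dots> = (\<Sum>\<sigma> | \<sigma> permutes {..<d}. \<Sum>i<d. if \<sigma> i = j then pmf \<mu> \<sigma> else 0)"
      by (rule sum.swap)
    also have "\<dots> = (\<Sum>\<sigma> | \<sigma> permutes {..<d}. pmf \<mu> \<sigma>)"
    proof (intro sum.cong refl)
      fix \<sigma> assume "\<sigma> \<in> {\<sigma>. \<sigma> permutes {..<d}}"
      then have p: "\<sigma> permutes {..<d}" by simp
      have "(\<Sum>i<d. if \<sigma> i = j then pmf \<mu> \<sigma> else 0) = (\<Sum>i<d. if i = inv_into UNIV \<sigma> j then pmf \<mu> \<sigma> else 0)"
        using permutes_inv_eq[OF p] by (intro sum.cong refl) metis
      also have "\<dots> = pmf \<mu> \<sigma>"
        using that permutes_in_image[OF permutes_inv[OF p], of j] by simp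
      finally show "(\<Sum>i<d. if \<sigma> i = j then pmf \<mu> \<sigma> else 0) = pmf \<mu> \<sigma>" .
    qed
    finally show ?thesis using total by simp
  qed
qed

text \<open>Inversion is an involution on permutations that preserves the weights and exchanges the
  event that \<open>i\<close> goes to \<open>j\<close> with the event that \<open>j\<close> goes to
  \<open>i\<close>.\<close>

lemma symmetric_single_ball_matrix:
  assumes "distribution_on_Sym d \<mu>" "symmetric_dist d \<mu>" "i < d" "j < d"
  shows "single_ball_matrix d \<mu> $$ (i, j) = single_ball_matrix d \<mu> $$ (j, i)"
  unfolding single_ball_matrix_index[OF assms(1,3,4)] single_ball_matrix_index[OF assms(1,4,3)]
proof (rule sum.reindex_bij_witness[of _ "inv_into UNIV" "inv_into UNIV"])
  fix \<sigma> assume "\<sigma> \<in> {\<sigma>. \<sigma> permutes {..<d}}"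
  then have p: "\<sigma> permutes {..<d}" by simp
  show "inv_into UNIV (inv_into UNIV \<sigma>) = \<sigma>" by (rule permutes_inv_inv[OF p])
  show "inv_into UNIV \<sigma> \<in> {\<sigma>. \<sigma> permutes {..<d}}" using permutes_inv[OF p] by simp
  have "inv_into UNIV \<sigma> j = i \<longleftrightarrow> \<sigma> i = j" using permutes_inv_eq[OF p] by simp
  then show "(if inv_into UNIV \<sigma> j = i then pmf \<mu> (inv_into UNIV \<sigma>) else 0) = (if \<sigma> i = j then pmf \<mu> \<sigma> else 0)"
    using assms(2) p by (simp add: symmetric_dist_def)
qed (auto simp: permutes_inv permutes_inv_inv)

section \<open>Asymptotic bounds along the sequence of distributions\<close>

theorem lemma1p2:
  fixes d :: nat
    and \<mu> :: "nat \<Rightarrow> (nat \<Rightarrow> nat) pmf"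
    and U :: "nat \<Rightarrow> real mat"
    and \<Phi> \<gamma> t_mix :: "nat \<Rightarrow> real"
  assumes "d \<ge> 2"
    and "\<And>n. distribution_on_Sym d (\<mu> n)"
    and "\<And>n. U n = single_ball_matrix d (\<mu> n)"
    and "\<And>n. irreducible_matrix d (U n)"
    and "\<And>n. \<Phi> n = cheeger_constant d (U n)"
    and "\<And>n. \<gamma> n = spectral_gap d (U n)"
    and "\<And>n. t_mix n = t_mix_single d (U n) (1 / sqrt (real n))"
  shows "(\<Phi> \<in> \<Omega>(\<lambda>n. 1) \<longrightarrow>
            (\<exists>e \<in> O(\<lambda>n. 1). \<forall>\<^sub>F n in sequentially.
               ln (real n) / (2 * \<gamma> n) - e n \<le> t_mix n) \<and>
            (\<exists>e \<in> O(\<lambda>n. ln (ln (real n))). \<forall>\<^sub>F n in sequentially.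
               t_mix n \<le> ln (real n) / (2 * \<gamma> n) + e n))
       \<and> ((\<forall>n. symmetric_dist d (\<mu> n)) \<longrightarrow>
            (\<exists>e \<in> O(\<lambda>n. 1 / \<gamma> n). \<forall>\<^sub>F n in sequentially.
               ln (real n) / (2 * \<gamma> n) - e n \<le> t_mix n) \<and>
            (\<exists>e \<in> O(\<lambda>n. 1 / \<gamma> n). \<forall>\<^sub>F n in sequentially.
               t_mix n \<le> ln (real n) / (2 * \<gamma> n) + e n))"
proof -
  have ds: "doubly_stochastic d (U n)" for n
    using assms(2,3) doubly_stochastic_single_ball_matrix by simp
  have gap: "doubly_stochastic.gap d (U n) = \<gamma> n" for n
    using doubly_stochastic.gap_def[OF ds] assms(6) by simp
  have \<Phi>: "0 < \<Phi> n" for n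
    using doubly_stochastic.irreducible_cheeger_pos[OF ds assms(1,4)] assms(5) by simp
  have \<gamma>_ge: "\<Phi> n / real d ^ 5 \<le> \<gamma> n" for n
    using doubly_stochastic.gap_ge_cheeger(1)[OF ds assms(1)] \<Phi> assms(5) gap by simp
  have \<gamma>: "0 < \<gamma> n" for n
  proof -
    have "0 < \<Phi> n / real d ^ 5" using \<Phi>[of n] assms(1) by simp
    then show ?thesis using \<gamma>_ge[of n] by linarith
  qed
  have lower: "\<forall>\<^sub>F n in sequentially. ln (real n) / (2 * \<gamma> n) - ln 2 / \<gamma> n \<le> t_mix n"
  proof (rule eventually_sequentiallyI[of 1])
    fix n :: nat assume "1 \<le> n"
    then show "ln (real n) / (2 * \<gamma> n) - ln 2 / \<gamma> n \<le> t_mix n"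
      using doubly_stochastic.t_mix_lower[OF ds assms(1), of n n] \<Phi>[of n] \<gamma>[of n]
      by (simp add: gap assms(5,7))
  qed
  have inv_O: "(\<lambda>n. c / \<gamma> n) \<in> O(\<lambda>n. 1 / \<gamma> n)" for c :: real
  proof (rule bigoI[of _ "\<bar>c\<bar>"])
    show "\<forall>\<^sub>F n in sequentially. norm (c / \<gamma> n) \<le> \<bar>c\<bar> * norm (1 / \<gamma> n)"
      by (simp add: abs_divide)
  qed
  have part1: "(\<exists>e \<in> O(\<lambda>n. 1). \<forall>\<^sub>F n in sequentially. ln (real n) / (2 * \<gamma> n) - e n \<le> t_mix n)
      \<and> (\<exists>e \<in> O(\<lambda>n. ln (ln (real n))). \<forall>\<^sub>F n in sequentially. t_mix n \<le> ln (real n) / (2 * \<gamma> n) + e n)"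
    if omega: "\<Phi> \<in> \<Omega>(\<lambda>n. 1)"
  proof -
    from omega obtain c where c: "0 < c" "\<forall>\<^sub>F n in sequentially. c * norm (1 :: real) \<le> norm (\<Phi> n)"
      by (elim landau_omega.bigE)
    \<comment> \<open>An eventual lower bound for the gaps: the constant of the \<Omega>-hypothesis
      pushed through \<open>gap_ge_cheeger\<close>.\<close>
    define \<kappa> where "\<kappa> = c / real d ^ 5"
    have \<kappa>: "0 < \<kappa>" using c(1) assms(1) by (simp add: \<kappa>_def)
    have ev: "\<forall>\<^sub>F n in sequentially. \<kappa> \<le> \<gamma> n"
      using c(2)
    proof eventually_elim
      case (elim n)
      then have "\<kappa> \<le> \<Phi> n / real d ^ 5"
        using \<Phi>[of n] unfolding \<kappa>_def by (intro divide_right_mono) auto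
      then show ?case using \<gamma>_ge[of n] by linarith
    qed
    have "(\<lambda>n. ln 2 / \<gamma> n) \<in> O(\<lambda>n. 1)"
    proof (rule bigoI[of _ "ln 2 / \<kappa>"])
      show "\<forall>\<^sub>F n in sequentially. norm (ln 2 / \<gamma> n) \<le> ln 2 / \<kappa> * norm (1 :: real)"
        using ev
      proof eventually_elim
        case (elim n)
        then have "ln 2 / \<gamma> n \<le> ln 2 / \<kappa>" using \<kappa> by (intro divide_left_mono) auto
        then show ?case using \<gamma>[of n] by simp
      qed
    qed
    moreover define K where "K = (d + 1) / \<kappa>"
    have "\<forall>\<^sub>F n in sequentially. t_mix n \<le> ln (real n) / (2 * \<gamma> n) + K * ln (ln (real n))"
    proof -
      have "filterlim (\<lambda>n. ln (real n)) at_top sequentially" by real_asymp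
      \<comment> \<open>The maximum gathers the two size conditions on \<open>ln n\<close> in
        \<open>t_mix_upper_general\<close>; both are fixed numbers because \<kappa> and
        \<open>K\<close> do not depend on \<open>n\<close>.\<close>
      then have "\<forall>\<^sub>F n in sequentially. max 1 ((2 * (1 + 1 / (2 * \<kappa>) + K)) ^ d) \<le> ln (real n)"
        unfolding filterlim_at_top by blast
      then show ?thesis using ev eventually_ge_at_top[of "1 :: nat"]
      proof eventually_elim
        case (elim n)
        have "1 \<le> ln (real n)" "(2 * (1 + 1 / (2 * \<kappa>) + K)) ^ d \<le> ln (real n)"
          using elim(1) by (simp_all only: max.bounded_iff)
        then have "t_mix_single d (U n) (1 / sqrt (real n))
            \<le> ln (real n) / (2 * doubly_stochastic.gap d (U n)) + K * ln (ln (real n))"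
          using elim(2,3) assms(1) \<kappa>
          by (intro doubly_stochastic.t_mix_upper_general[OF ds, of \<kappa>]) (simp_all only: gap K_def)
        then show ?case by (simp add: gap assms(7))
      qed
    qed
    moreover have "(\<lambda>n. K * ln (ln (real n))) \<in> O(\<lambda>n. ln (ln (real n)))" by simp
    ultimately show ?thesis
      using bexI[where P = "\<lambda>e. \<forall>\<^sub>F n in sequentially. ln (real n) / (2 * \<gamma> n) - e n \<le> t_mix n", OF lower]
        bexI[where P = "\<lambda>e. \<forall>\<^sub>F n in sequentially. t_mix n \<le> ln (real n) / (2 * \<gamma> n) + e n"
          and x = "\<lambda>n. K * ln (ln (real n))"]
      by simp
  qed
  have part2: "(\<exists>e \<in> O(\<lambda>n. 1 / \<gamma> n). \<forall>\<^sub>F n in sequentially. ln (real n) / (2 * \<gamma> n) - e n \<le> t_mix n)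
      \<and> (\<exists>e \<in> O(\<lambda>n. 1 / \<gamma> n). \<forall>\<^sub>F n in sequentially. t_mix n \<le> ln (real n) / (2 * \<gamma> n) + e n)"
    if sym: "\<forall>n. symmetric_dist d (\<mu> n)"
  proof -
    have "\<forall>\<^sub>F n in sequentially. t_mix n \<le> ln (real n) / (2 * \<gamma> n) + ln d / \<gamma> n"
    proof (rule eventually_sequentiallyI[of 1])
      fix n :: nat assume n: "1 \<le> n"
      have "U n $$ (i, j) = U n $$ (j, i)" if "i < d" "j < d" for i j
        using symmetric_single_ball_matrix[OF assms(2) spec[OF sym] that] assms(3) by simp
      then show "t_mix n \<le> ln (real n) / (2 * \<gamma> n) + ln d / \<gamma> n"
        using doubly_stochastic.t_mix_upper_symmetric[OF ds, of n n] n \<gamma>[of n] assms(1)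
        by (simp add: gap assms(7))
    qed
    then show ?thesis
      using bexI[where P = "\<lambda>e. \<forall>\<^sub>F n in sequentially. ln (real n) / (2 * \<gamma> n) - e n \<le> t_mix n",
          OF lower inv_O]
        bexI[where P = "\<lambda>e. \<forall>\<^sub>F n in sequentially. t_mix n \<le> ln (real n) / (2 * \<gamma> n) + e n",
          OF _ inv_O]
      by blast
  qed
  from part1 part2 show ?thesis by blast
qed

end
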